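(* Consider the constrained convex program and its standing assumptions (i)–(iv) described in the context, and assume further that: (a) $h=\mathrm{Ind}_{\mathcal{C}}$ where $\mathcal{C}$ is compact and $(\nu,q)$-uniformly convex for some $q\ge 2$ and $\nu>0$; (b) for some $\epsilon>0$, $\inf\{\|\nabla f(x)+\sum_{i=1}^m z_i\nabla g_i(x)\| : (x,z)\in\mathcal{A}_\epsilon,\ x\in\mathcal{C}\}>0$, with $\mathcal{A}_\epsilon$ as defined in the context. Let $\{(x^k,z^k)\}$ be generated by the algorithm described in the context with parameters satisfying: $\{\lambda_k\}$ positive and increasing, $\lambda_k=\Theta(k^{\tau})$ and $\lambda_{k+1}-\lambda_k=\mathcal{O}(k^{-(1-\tau)})$ for some $\tau\in(0,1)$; for every $k$, $\alpha_k$ is the short stepsize (defined in the context) at $(x^k,z^k,v^k,\lambda_k)$; $\{\sigma_k\}$ positive with $\sigma_k\le\lambda_k$ and $\sigma_k=\Theta(k^{-(1+\gamma)})$ for some $\gamma>0$. Let $L^*$ be the optimal value of the program, $T_k:=[\mathcal{L}_{\lambda_k}(x^k,z^k)-L^*]_+$, and $\mu:=1-2/q\in[0,1)$. Then $$T_k=\mathcal{O}\Big(\max\Big\{\frac{1}{k^{\frac{1}{1+\mu}}},\frac{1}{k^{\frac{2-2\tau}{1+\mu}}}\Big\}\Big).$$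
   Context: Conventions: $\|\cdot\|$ is the Euclidean norm, vector inequalities and maxima are componentwise, $[a]_+=\max\{a,0\}$ (componentwise for vectors), $\mathrm{dom}\,h=\{x:h(x)<\infty\}$, $\mathrm{Ind}_{\mathcal{C}}$ is the indicator function ($0$ on $\mathcal{C}$, $+\infty$ elsewhere). Asymptotic notation is as $k\to\infty$. Problem: $\min_{x\in\mathbb{R}^n} f(x)+h(x)$ subject to $g(x):=(g_1(x),\dots,g_m(x))^T\le 0$. Standing assumptions: (i) $f:\mathbb{R}^n\to\mathbb{R}$ is convex and differentiable with $L_f$-Lipschitz gradient, $L_f>0$. (ii) $h:\mathbb{R}^n\to(-\infty,+\infty]$ is proper, closed, convex, $\sup_{x,x'\in\mathrm{dom}\,h}\|x-x'\|\le D$ for some finite $D>0$, and for every $u\in\mathbb{R}^n$ the problem $\min_v\langle v,u\rangle+h(v)$ has a minimizer. (iii) Each $g_i:\mathbb{R}^n\to\mathbb{R}$ is convex and differentiable, and there is $L_{g_i}>0$ with $\|\nabla g_i(x)-\nabla g_i(x')\|\le L_{g_i}\|x-x'\|$ for all $x,x'\in\mathrm{dom}\,h$. (iv) There is a KKT point $(x^*,z^* )$: $0\in\nabla f(x^* )+\partial h(x^* )+\sum_{i=1}^m z_i^*\nabla g_i(x^* )$, $g(x^* )\le 0$, $z^*\ge 0$, $\langle z^*,g(x^* )\rangle=0$. Fix constants $B_i>0$ with $\|\nabla g_i(x)\|\le B_i$ and $|g_i(x)-g_i(x')|\le B_i\|x-x'\|$ for all $x,x'\in\mathrm{dom}\,h$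 (these exist under the assumptions). Uniform convexity: a convex set $\mathcal{D}\subseteq\mathbb{R}^n$ is $(\nu,q)$-uniformly convex ($q\ge2$, $\nu>0$) if for all $x,y\in\mathcal{D}$, $t\in[0,1]$ and $w\in\mathbb{R}^n$ with $\|w\|=1$, one has $tx+(1-t)y+t(1-t)\nu\|x-y\|^q w\in\mathcal{D}$. For $\epsilon>0$: $\mathcal{A}_\epsilon=\{(x,z)\in\mathbb{R}^n\times\mathbb{R}^m_+ : g_i(x)\le\epsilon\ \forall i,\text{ and for every } i,\ g_i(x)<-\epsilon\text{ implies } z_i=0\}$. For $\lambda>0$, let $\Psi_\lambda(x,z)=\frac{\lambda}{2}\sum_{i=1}^m\big([g_i(x)+z_i/\lambda]_+^2-(z_i/\lambda)^2\big)$, $F_\lambda(x,z)=f(x)+\Psi_\lambda(x,z)$, and $\mathcal{L}_\lambda(x,z)=F_\lambda(x,z)+h(x)$ (augmented Lagrangian). Let $L_\Psi(x,z)=\sum_{i=1}^m(\lambda B_i^2+L_{g_i}[\lambda g_i(x)+z_i]_+)$ (depending on $\lambda$; $L_\Psi(x^k,z^k)$ is taken with $\lambda=\lambda_k$). Gap function: $G_{z,\lambda}(x)=\langle\nabla_xF_\lambda(x,z),x-v^+\rangle+h(x)-h(v^+)$ for any $v^+\in\mathrm{Argmin}_v\langle\nabla_xF_\lambda(x,z),v\rangle+h(v)$ (independent of the choice). Short stepsize at $(x,z,v^+,\lambda)$: it equals $0$ if $G_{z,\lambda}(x)=\|v^+-x\|=0$, and $\min\big\{1,\frac{G_{z,\lambda}(x)}{(L_\Psi(x,z)+L_f)\|v^+-x\|^2}\big\}$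 otherwise. Algorithm: choose $(x^0,z^0)\in\mathrm{dom}\,h\times\mathbb{R}^m_+$, a positive increasing sequence $\{\lambda_k\}$ ($\lambda_{k+1}>\lambda_k>0$) with $\lambda_k\to\infty$, a positive summable sequence $\{\sigma_k\}$ with $\sigma_k\le\lambda_k$, and stepsizes $\alpha_k\in[0,1]$. For $k=0,1,2,\dots$: $v^k\in\mathrm{Argmin}_{v}\ \langle\nabla_xF_{\lambda_k}(x^k,z^k),v\rangle+h(v)$ (any minimizer); $x^{k+1}=x^k+\alpha_k(v^k-x^k)$; $z^{k+1}=z^k+\sigma_k\max\{-z^k/\lambda_k,\ g(x^{k+1})\}$. *)

theory Defs
  imports "HOL-Analysis.Analysis" "HOL-Library.Landau_Symbols"
begin

definition grad :: "('a::real_inner \<Rightarrow> real) \<Rightarrow> 'a \<Rightarrow> 'a" where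
  "grad f x = (THE D. GDERIV f x :> D)"

abbreviation pos_part :: "'a::{zero,ord} \<Rightarrow> 'a" where
  "pos_part a \<equiv> max a 0"

definition edom :: "('a \<Rightarrow> ereal) \<Rightarrow> 'a set" where
  "edom h = {x. h x < \<infinity>}"

definition eepigraph :: "('a \<Rightarrow> ereal) \<Rightarrow> ('a \<times> real) set" where
  "eepigraph h = {(x, r). h x \<le> ereal r}"

definition proper_closed_convex :: "('a::real_normed_vector \<Rightarrow> ereal) \<Rightarrow> bool" where
  "proper_closed_convex h \<longleftrightarrow>
     edom h \<noteq> {} \<and> (\<forall>x. h x \<noteq> -\<infinity>) \<and> closed (eepigraph h) \<and> convex (eepigraph h)"

definition Ind :: "'a set \<Rightarrow> 'a \<Rightarrow> ereal" where
  "Ind C x = (if x \<in> C then 0 else \<infinity>)"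

text \<open>When \<open>h\<close> is proper, this set is empty at points outside \<open>edom h\<close>, as it should be.\<close>

definition subdifferential :: "('a::real_inner \<Rightarrow> ereal) \<Rightarrow> 'a \<Rightarrow> 'a set" where
  "subdifferential h x = {s. \<forall>y. h x + ereal (s \<bullet> (y - x)) \<le> h y}"

definition lin_argmin :: "('a::real_inner \<Rightarrow> ereal) \<Rightarrow> 'a \<Rightarrow> 'a set" where
  "lin_argmin h u = {v. \<forall>w. ereal (v \<bullet> u) + h v \<le> ereal (w \<bullet> u) + h w}"

definition uniformly_convex_set :: "real \<Rightarrow> real \<Rightarrow> 'a::real_normed_vector set \<Rightarrow> bool" where
  "uniformly_convex_set \<nu> q S \<longleftrightarrow> convex S \<and> \<nu> > 0 \<and> q \<ge> 2 \<and>
     (\<forall>x\<in>S. \<forall>y\<in>S. \<forall>t\<in>{0..1}. \<forall>w. norm w = 1 \<longrightarrow>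
        t *\<^sub>R x + (1 - t) *\<^sub>R y + (t * (1 - t) * \<nu> * norm (x - y) powr q) *\<^sub>R w \<in> S)"

definition kkt_point ::
  "(real^'n \<Rightarrow> real) \<Rightarrow> (real^'n \<Rightarrow> real^'m) \<Rightarrow> (real^'n \<Rightarrow> ereal) \<Rightarrow> real^'n \<Rightarrow> real^'m \<Rightarrow> bool" where
  "kkt_point f g h x z \<longleftrightarrow>
     (\<exists>s\<in>subdifferential h x. grad f x + s + (\<Sum>i\<in>UNIV. z $ i *\<^sub>R grad (\<lambda>y. g y $ i) x) = 0) \<and>
     (\<forall>i. g x $ i \<le> 0) \<and> (\<forall>i. z $ i \<ge> 0) \<and> z \<bullet> g x = 0"

definition standing_assumptions ::
  "(real^'n \<Rightarrow> real) \<Rightarrow> (real^'n \<Rightarrow> real^'m) \<Rightarrow> (real^'n \<Rightarrow> ereal) \<Rightarrow> real \<Rightarrow> real^'m \<Rightarrow> bool" where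
  "standing_assumptions f g h Lf Lg \<longleftrightarrow>
     (convex_on UNIV f \<and> (\<forall>x. f differentiable (at x)) \<and> Lf > 0 \<and>
        (\<forall>x y. norm (grad f x - grad f y) \<le> Lf * norm (x - y))) \<and>
     (proper_closed_convex h \<and>
        (\<exists>D>0. \<forall>x\<in>edom h. \<forall>y\<in>edom h. norm (x - y) \<le> D) \<and>
        (\<forall>u. lin_argmin h u \<noteq> {})) \<and>
     (\<forall>i. convex_on UNIV (\<lambda>y. g y $ i) \<and> (\<forall>x. (\<lambda>y. g y $ i) differentiable (at x)) \<and> Lg $ i > 0 \<and>
        (\<forall>x\<in>edom h. \<forall>y\<in>edom h.
           norm (grad (\<lambda>y. g y $ i) x - grad (\<lambda>y. g y $ i) y) \<le> Lg $ i * norm (x - y))) \<and>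
     (\<exists>x z. kkt_point f g h x z)"

definition constraint_bounds ::
  "(real^'n \<Rightarrow> real^'m) \<Rightarrow> (real^'n \<Rightarrow> ereal) \<Rightarrow> real^'m \<Rightarrow> bool" where
  "constraint_bounds g h B \<longleftrightarrow>
     (\<forall>i. B $ i > 0 \<and>
        (\<forall>x\<in>edom h. norm (grad (\<lambda>y. g y $ i) x) \<le> B $ i) \<and>
        (\<forall>x\<in>edom h. \<forall>y\<in>edom h. \<bar>g x $ i - g y $ i\<bar> \<le> B $ i * norm (x - y)))"

definition optimal_value ::
  "(real^'n \<Rightarrow> real) \<Rightarrow> (real^'n \<Rightarrow> real^'m) \<Rightarrow> (real^'n \<Rightarrow> ereal) \<Rightarrow> ereal" where
  "optimal_value f g h = (INF x\<in>{x. \<forall>i. g x $ i \<le> 0}. ereal (f x) + h x)"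

definition approx_compl_set ::
  "(real^'n \<Rightarrow> real^'m) \<Rightarrow> real \<Rightarrow> ((real^'n) \<times> (real^'m)) set" where
  "approx_compl_set g \<epsilon> =
     {(x, z). (\<forall>i. z $ i \<ge> 0) \<and> (\<forall>i. g x $ i \<le> \<epsilon>) \<and> (\<forall>i. g x $ i < - \<epsilon> \<longrightarrow> z $ i = 0)}"

definition Psi :: "(real^'n \<Rightarrow> real^'m) \<Rightarrow> real \<Rightarrow> real^'n \<Rightarrow> real^'m \<Rightarrow> real" where
  "Psi g l x z = l / 2 * (\<Sum>i\<in>UNIV. ((pos_part (g x $ i + z $ i / l))\<^sup>2 - (z $ i / l)\<^sup>2))"

definition F_AL ::
  "(real^'n \<Rightarrow> real) \<Rightarrow> (real^'n \<Rightarrow> real^'m) \<Rightarrow> real \<Rightarrow> real^'n \<Rightarrow> real^'m \<Rightarrow> real" where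
  "F_AL f g l x z = f x + Psi g l x z"

definition aug_lagrangian ::
  "(real^'n \<Rightarrow> real) \<Rightarrow> (real^'n \<Rightarrow> real^'m) \<Rightarrow> (real^'n \<Rightarrow> ereal) \<Rightarrow> real \<Rightarrow> real^'n \<Rightarrow> real^'m \<Rightarrow> ereal" where
  "aug_lagrangian f g h l x z = ereal (F_AL f g l x z) + h x"

definition L_Psi ::
  "(real^'n \<Rightarrow> real^'m) \<Rightarrow> real^'m \<Rightarrow> real^'m \<Rightarrow> real \<Rightarrow> real^'n \<Rightarrow> real^'m \<Rightarrow> real" where
  "L_Psi g B Lg l x z =
     (\<Sum>i\<in>UNIV. (l * (B $ i)\<^sup>2 + Lg $ i * pos_part (l * g x $ i + z $ i)))"

definition grad_F ::
  "(real^'n \<Rightarrow> real) \<Rightarrow> (real^'n \<Rightarrow> real^'m) \<Rightarrow> real \<Rightarrow> real^'n \<Rightarrow> real^'m \<Rightarrow> real^'n" where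
  "grad_F f g l x z = grad (\<lambda>y. F_AL f g l y z) x"

text \<open>The value does not depend on which minimizer \<open>SOME\<close> selects.\<close>

definition gap ::
  "(real^'n \<Rightarrow> real) \<Rightarrow> (real^'n \<Rightarrow> real^'m) \<Rightarrow> (real^'n \<Rightarrow> ereal) \<Rightarrow> real \<Rightarrow> real^'n \<Rightarrow> real^'m \<Rightarrow> ereal" where
  "gap f g h l x z =
     (let u = grad_F f g l x z; v = (SOME v. v \<in> lin_argmin h u)
      in ereal (u \<bullet> (x - v)) + h x - h v)"

text \<open>The gap is finite for every \<open>x\<close> in \<open>edom h\<close>, which contains all iterates,
  so \<open>real_of_ereal\<close> loses nothing there.\<close>

definition short_step ::
  "(real^'n \<Rightarrow> real) \<Rightarrow> (real^'n \<Rightarrow> real^'m) \<Rightarrow> (real^'n \<Rightarrow> ereal) \<Rightarrow> real \<Rightarrow> real^'m \<Rightarrow> real^'m \<Rightarrow>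
   real \<Rightarrow> real^'n \<Rightarrow> real^'m \<Rightarrow> real^'n \<Rightarrow> real" where
  "short_step f g h Lf Lg B l x z v =
     (let G = real_of_ereal (gap f g h l x z)
      in if G = 0 \<and> norm (v - x) = 0 then 0
         else min 1 (G / ((L_Psi g B Lg l x z + Lf) * (norm (v - x))\<^sup>2)))"

definition algorithm_run ::
  "(real^'n \<Rightarrow> real) \<Rightarrow> (real^'n \<Rightarrow> real^'m) \<Rightarrow> (real^'n \<Rightarrow> ereal) \<Rightarrow>
   (nat \<Rightarrow> real) \<Rightarrow> (nat \<Rightarrow> real) \<Rightarrow> (nat \<Rightarrow> real) \<Rightarrow>
   (nat \<Rightarrow> real^'n) \<Rightarrow> (nat \<Rightarrow> real^'n) \<Rightarrow> (nat \<Rightarrow> real^'m) \<Rightarrow> bool" where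
  "algorithm_run f g h lam sig \<alpha> x v z \<longleftrightarrow>
     x 0 \<in> edom h \<and> (\<forall>i. z 0 $ i \<ge> 0) \<and>
     (\<forall>k. 0 < lam k \<and> lam k < lam (Suc k)) \<and> filterlim lam at_top sequentially \<and>
     (\<forall>k. 0 < sig k \<and> sig k \<le> lam k) \<and> summable sig \<and>
     (\<forall>k. \<alpha> k \<in> {0..1}) \<and>
     (\<forall>k. v k \<in> lin_argmin h (grad_F f g (lam k) (x k) (z k)) \<and>
          x (Suc k) = x k + \<alpha> k *\<^sub>R (v k - x k) \<and>
          z (Suc k) = z k + sig k *\<^sub>R (\<chi> i. max (- (z k $ i) / lam k) (g (x (Suc k)) $ i)))"

end

theory Submission
  imports Defs
begin

text \<open>
  Let \<open>T\<close> be the positive part of the excess of the augmented Lagrangian over the optimal value. By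
  convexity the Frank--Wolfe gap \<open>G\<close> dominates \<open>T\<close>. The short step decreases the augmented Lagrangian
  by at least \<open>min (G/2) (G\<^sup>2 / (2 L d\<^sup>2))\<close>, where \<open>d\<close> is the distance from \<open>x\<^sup>k\<close> to \<open>v\<^sup>k\<close> and
  \<open>L = O(\<lambda>\<^sub>k)\<close>. The KKT multiplier makes the linear penalty exact, hence the squared constraint
  violation is \<open>O(1/\<lambda>\<^sub>k\<^sup>2 + T/\<lambda>\<^sub>k)\<close>, and updating the parameters costs at most
  \<open>O(k\<^sup>\<tau>\<^sup>-\<^sup>1)\<close> times this quantity. If \<open>d\<^sup>2 = O(G\<^sup>1\<^sup>-\<^sup>\<mu>)\<close>, the outcome is the recursion
  \<open>T' \<le> T - min (T/2) (c T\<^sup>1\<^sup>+\<^sup>\<mu> k\<^sup>-\<^sup>\<tau>) + C k\<^sup>-\<^sup>1\<^sup>-\<^sup>\<tau> + C T/k\<close>, which forces \<open>T = O(k\<^sup>-\<^sup>\<rho>)\<close>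
  as soon as \<open>\<rho> (1 + \<mu>) \<le> 1\<close> and \<open>\<rho> \<mu> + \<tau> < 1\<close>.

  The recursion is used twice. Compactness alone gives the distance estimate with \<open>\<mu> = 1\<close>, and
  \<open>\<rho> = 0\<close> shows that \<open>T\<close> is bounded. Therefore the iterates eventually lie in the approximate
  complementarity set, the gradient is bounded away from zero, and uniform convexity yields
  \<open>G \<ge> c d\<^sup>q\<close>, that is, the distance estimate with \<open>\<mu> = 1 - 2/q\<close>.
\<close>

section \<open>Gradients, convexity and uniform convexity\<close>

lemma grad_eq:
  fixes f :: "'a::real_inner \<Rightarrow> real"
  assumes "GDERIV f x :> D"
  shows "grad f x = D"
  unfolding grad_def
proof (rule the_equality[where P = "\<lambda>D. GDERIV f x :> D", OF assms])
  fix E assume "GDERIV f x :> E"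
  then have "(\<lambda>h. inner h E) = (\<lambda>h. inner h D)"
    using assms unfolding gderiv_def by (rule has_derivative_unique)
  then have "inner (E - D) E = inner (E - D) D" by metis
  then have "inner (E - D) (E - D) = 0" by (simp add: inner_diff_right)
  then show "E = D" by simp
qed

text \<open>Since \<open>grad\<close> is defined by \<open>THE\<close>, a representing vector must
  be exhibited: the derivative is linear, so its values on an orthonormal basis supply one.\<close>

lemma GDERIV_grad:
  fixes f :: "'a::euclidean_space \<Rightarrow> real"
  assumes "f differentiable (at x)"
  shows "GDERIV f x :> grad f x"
proof -
  obtain f' where f': "(f has_derivative f') (at x)"
    using assms by (auto simp: differentiable_def)
  then have "linear f'" by (rule has_derivative_linear)
  have "f' h = h \<bullet> (\<Sum>b\<in>Basis. f' b *\<^sub>R b)" for h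
  proof -
    have "f' h = f' (\<Sum>b\<in>Basis. (h \<bullet> b) *\<^sub>R b)" by (simp add: euclidean_representation)
    also have "\<dots> = (\<Sum>b\<in>Basis. (h \<bullet> b) * f' b)"
      using \<open>linear f'\<close> by (simp add: linear_sum linear_cmul)
    finally show ?thesis by (simp add: inner_sum_right mult.commute)
  qed
  then have "GDERIV f x :> (\<Sum>b\<in>Basis. f' b *\<^sub>R b)"
    unfolding gderiv_def using f' by (metis (no_types, lifting) ext)
  then show ?thesis by (simp add: grad_eq)
qed

lemma has_field_derivative_along_line:
  fixes f :: "'a::euclidean_space \<Rightarrow> real"
  assumes "\<And>x. f differentiable (at x)"
  shows "((\<lambda>t. f (x + t *\<^sub>R d)) has_real_derivative grad f (x + t *\<^sub>R d) \<bullet> d) (at t)"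
proof -
  have 1: "((\<lambda>t. x + t *\<^sub>R d) has_derivative (\<lambda>s. s *\<^sub>R d)) (at t)"
    by (auto intro!: derivative_eq_intros)
  have "((\<lambda>t. f (x + t *\<^sub>R d)) has_derivative (\<lambda>s. (s *\<^sub>R d) \<bullet> grad f (x + t *\<^sub>R d))) (at t)"
    using has_derivative_compose[OF 1] GDERIV_grad[OF assms] unfolding gderiv_def by blast
  then show ?thesis
    unfolding has_field_derivative_def by (simp add: inner_commute mult_commute_abs)
qed

text \<open>Restriction to the line through \<open>x\<close> and \<open>y\<close> reduces this to
  the tangent inequality for convex functions of one real variable.\<close>

lemma convex_on_imp_above_grad:
  fixes f :: "'a::euclidean_space \<Rightarrow> real"
  assumes "convex_on UNIV f" "\<And>x. f differentiable (at x)"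
  shows "f x + grad f x \<bullet> (y - x) \<le> f y"
proof -
  define \<phi> where "\<phi> t = f (x + t *\<^sub>R (y - x))" for t
  have "convex_on UNIV \<phi>"
  proof (rule convex_onI)
    fix t a b :: real assume t: "0 < t" "t < 1"
    have "x + ((1 - t) *\<^sub>R a + t *\<^sub>R b) *\<^sub>R (y - x)
        = (1 - t) *\<^sub>R (x + a *\<^sub>R (y - x)) + t *\<^sub>R (x + b *\<^sub>R (y - x))"
      by (simp add: algebra_simps)
    then show "\<phi> ((1 - t) *\<^sub>R a + t *\<^sub>R b) \<le> (1 - t) * \<phi> a + t * \<phi> b"
      unfolding \<phi>_def using convex_onD[OF assms(1), of t] t by simp
  qed simp
  moreover have "(\<phi> has_real_derivative grad f x \<bullet> (y - x)) (at 0)"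
    using has_field_derivative_along_line[OF assms(2), of x "y - x" 0] by (simp add: \<phi>_def[abs_def])
  ultimately have "(grad f x \<bullet> (y - x)) * (1 - 0) \<le> \<phi> 1 - \<phi> 0"
    by (intro convex_on_imp_above_tangent[where A = UNIV]) auto
  then show ?thesis by (simp add: \<phi>_def)
qed

text \<open>The descent lemma, localized to a convex set: the segment from \<open>x\<close> to
  \<open>y\<close> stays in \<open>S\<close>, so a gradient that is Lipschitz on the domain of
  \<open>h\<close> alone can be treated.\<close>

lemma Lipschitz_grad_upper_bound:
  fixes f :: "'a::euclidean_space \<Rightarrow> real"
  assumes "convex S" "x \<in> S" "y \<in> S" "\<And>x. f differentiable (at x)"
    and lip: "\<And>x y. x \<in> S \<Longrightarrow> y \<in> S \<Longrightarrow> norm (grad f x - grad f y) \<le> L * norm (x - y)"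
  shows "f y \<le> f x + grad f x \<bullet> (y - x) + L / 2 * (norm (y - x))\<^sup>2"
proof -
  define d where "d = y - x"
  \<comment> \<open>Along the segment, \<open>\<phi>\<close> is \<open>f\<close> minus its quadratic
    model, up to the constant \<open>f x\<close>. Cauchy-Schwarz and the Lipschitz bound make its
    derivative nonpositive.\<close>
  define \<phi> where "\<phi> t = f (x + t *\<^sub>R d) - t * (grad f x \<bullet> d) - L / 2 * t\<^sup>2 * (norm d)\<^sup>2" for t
  define \<phi>' where "\<phi>' t = grad f (x + t *\<^sub>R d) \<bullet> d - grad f x \<bullet> d - L * t * (norm d)\<^sup>2" for t
  have der: "(\<phi> has_real_derivative \<phi>' t) (at t)" for t
    unfolding \<phi>_def \<phi>'_def
    by (rule derivative_eq_intros has_field_derivative_along_line[OF assms(4)] refl | simp)+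
  have "\<phi>' t \<le> 0" if "0 \<le> t" "t \<le> 1" for t
  proof -
    have "x + t *\<^sub>R d = (1 - t) *\<^sub>R x + t *\<^sub>R y" by (simp add: d_def algebra_simps)
    then have "x + t *\<^sub>R d \<in> S" using assms(1-3) that by (simp add: convexD)
    then have "norm (grad f (x + t *\<^sub>R d) - grad f x) \<le> L * (t * norm d)"
      using lip[of "x + t *\<^sub>R d" x] assms(2) that by simp
    then have "norm (grad f (x + t *\<^sub>R d) - grad f x) * norm d \<le> L * (t * norm d) * norm d"
      by (rule mult_right_mono) simp
    moreover have "(grad f (x + t *\<^sub>R d) - grad f x) \<bullet> d
        \<le> norm (grad f (x + t *\<^sub>R d) - grad f x) * norm d" by (rule norm_cauchy_schwarz)
    ultimately show ?thesis
      by (simp add: \<phi>'_def inner_diff_left power2_eq_square algebra_simps)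
  qed
  then have "\<phi> 1 \<le> \<phi> 0"
    using der DERIV_nonpos_imp_nonincreasing[of 0 1 \<phi>] by (meson zero_le_one)
  then show ?thesis by (simp add: \<phi>_def d_def)
qed

lemma convex_iterates_in:
  fixes x v :: "nat \<Rightarrow> 'a::real_vector"
  assumes "convex S" "x 0 \<in> S" "\<And>k. v k \<in> S" "\<And>k. \<alpha> k \<in> {0..1}"
    and step: "\<And>k. x (Suc k) = x k + \<alpha> k *\<^sub>R (v k - x k)"
  shows "x k \<in> S"
proof (induction k)
  case (Suc k)
  have "x (Suc k) = (1 - \<alpha> k) *\<^sub>R x k + \<alpha> k *\<^sub>R v k"
    unfolding step by (simp add: algebra_simps)
  then show ?case using Suc assms(1) assms(3,4)[of k] by (simp add: convexD)
qed (rule assms(2))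

text \<open>With \<open>t = 1/2\<close> and \<open>w = - u / norm u\<close>, uniform convexity keeps
  the midpoint of \<open>x\<close> and \<open>v\<close> in \<open>S\<close> after a push of length
  \<open>\<nu> / 4 * norm (x - v) powr q\<close> against \<open>u\<close>. Minimality of
  \<open>v\<close>, tested at the pushed point, gives the bound.\<close>

lemma uniformly_convex_set_gap:
  fixes S :: "'a::real_inner set"
  assumes S: "uniformly_convex_set \<nu> q S" and "x \<in> S" "v \<in> S"
    and min: "\<And>y. y \<in> S \<Longrightarrow> v \<bullet> u \<le> y \<bullet> u"
  shows "\<nu> / 2 * norm u * norm (x - v) powr q \<le> u \<bullet> (x - v)"
proof (cases "u = 0")
  case False
  define w where "w = (- 1 / norm u) *\<^sub>R u"
  have "norm w = 1" using False by (simp add: w_def)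
  then have "(1/2) *\<^sub>R x + (1 - 1/2) *\<^sub>R v + (1/2 * (1 - 1/2) * \<nu> * norm (x - v) powr q) *\<^sub>R w \<in> S"
    using S assms(2,3) unfolding uniformly_convex_set_def
    by (metis (no_types, opaque_lifting) atLeastAtMost_iff half_gt_zero_iff less_eq_real_def zero_less_one
        divide_le_eq_1 one_le_numeral zero_le_numeral zero_le_divide_1_iff)
  from min[OF this] have
    "v \<bullet> u \<le> (x \<bullet> u) / 2 + (v \<bullet> u) / 2 + \<nu> / 4 * norm (x - v) powr q * (w \<bullet> u)"
    by (simp add: inner_add_left)
  moreover have "w \<bullet> u = - norm u"
    using False by (simp add: w_def dot_square_norm power2_eq_square)
  ultimately show ?thesis
    by (simp add: inner_diff_right inner_commute[of u] algebra_simps)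
qed simp

section \<open>The scalar augmented Lagrangian term\<close>

text \<open>The term of a single constraint with value \<open>a\<close> and multiplier
  \<open>b\<close>; the estimates of \<open>Psi\<close> are made constraint by constraint.\<close>

definition psi :: "real \<Rightarrow> real \<Rightarrow> real \<Rightarrow> real" where
  "psi l a b = l / 2 * ((max (a + b / l) 0)\<^sup>2 - (b / l)\<^sup>2)"

lemma Psi_eq_sum_psi: "Psi g l x z = (\<Sum>i\<in>UNIV. psi l (g x $ i) (z $ i))"
  by (simp add: Psi_def psi_def sum_distrib_left)

text \<open>The square of the positive part is convex with the 2-Lipschitz derivative
  \<open>2 * max s 0\<close>; these are its tangent and descent inequalities. After splitting
  \<open>s\<close> and \<open>t\<close> into positive and negative parts, the slacks are
  \<open>(p - r)\<^sup>2 + 2 * p * n\<close> and \<open>(n - m)\<^sup>2 + 2 * r * m\<close>.\<close>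

lemma max_square_bounds:
  fixes s t :: real
  shows "(max s 0)\<^sup>2 + 2 * max s 0 * (t - s) \<le> (max t 0)\<^sup>2"
    and "(max t 0)\<^sup>2 \<le> (max s 0)\<^sup>2 + 2 * max s 0 * (t - s) + (t - s)\<^sup>2"
proof -
  define p m r n where "p = max s 0" and "m = max (- s) 0" and "r = max t 0" and "n = max (- t) 0"
  have st: "s = p - m" "t = r - n" and nonneg: "0 \<le> p" "0 \<le> m" "0 \<le> r" "0 \<le> n"
    and pm: "p * m = 0" and rn: "r * n = 0"
    by (auto simp: p_def m_def r_def n_def max_def)
  have "0 \<le> (p - r)\<^sup>2" "0 \<le> p * n" "0 \<le> (n - m)\<^sup>2" "0 \<le> r * m"
    using nonneg by simp_all
  then have "p\<^sup>2 + 2 * p * (t - s) \<le> r\<^sup>2"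
    "r\<^sup>2 \<le> p\<^sup>2 + 2 * p * (t - s) + (t - s)\<^sup>2"
    using pm rn unfolding st by (auto simp: power2_eq_square algebra_simps)
  then show "(max s 0)\<^sup>2 + 2 * max s 0 * (t - s) \<le> (max t 0)\<^sup>2"
    and "(max t 0)\<^sup>2 \<le> (max s 0)\<^sup>2 + 2 * max s 0 * (t - s) + (t - s)\<^sup>2"
    by (simp_all add: p_def r_def)
qed

lemma max_scaled:
  fixes l a b :: real
  assumes "l > 0"
  shows "max (l * a + b) 0 = l * max (a + b / l) 0"
proof -
  have "l * a + b = l * (a + b / l)" using assms by (simp add: distrib_left)
  then show ?thesis using assms by (simp add: max_mult_distrib_left)
qed

lemma psi_above_tangent:
  assumes "l > 0"
  shows "psi l a b + max (l * a + b) 0 * (a' - a) \<le> psi l a' b"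
proof -
  have "l / 2 * ((max (a + b / l) 0)\<^sup>2 + 2 * max (a + b / l) 0 * (a' - a))
      \<le> l / 2 * (max (a' + b / l) 0)\<^sup>2"
    using max_square_bounds(1)[of "a + b / l" "a' + b / l"] assms by (intro mult_left_mono) auto
  then show ?thesis
    unfolding psi_def max_scaled[OF assms] by (simp add: algebra_simps)
qed

lemma psi_quadratic_upper_bound:
  assumes "l > 0"
  shows "psi l a' b \<le> psi l a b + max (l * a + b) 0 * (a' - a) + l / 2 * (a' - a)\<^sup>2"
proof -
  have "l / 2 * (max (a' + b / l) 0)\<^sup>2
      \<le> l / 2 * ((max (a + b / l) 0)\<^sup>2 + 2 * max (a + b / l) 0 * (a' - a) + (a' - a)\<^sup>2)"
    using max_square_bounds(2)[of "a' + b / l" "a + b / l"] assms by (intro mult_left_mono) auto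
  then show ?thesis
    unfolding psi_def max_scaled[OF assms] by (simp add: algebra_simps)
qed

text \<open>A nonnegative multiplier only enlarges the positive part, so the pure quadratic penalty
  survives up to the square subtracted in \<open>psi\<close>.\<close>

lemma psi_lower_bound:
  assumes "l > 0" "b \<ge> 0"
  shows "l / 2 * (max a 0)\<^sup>2 - b\<^sup>2 / (2 * l) \<le> psi l a b"
proof -
  have "(max a 0)\<^sup>2 \<le> (max (a + b / l) 0)\<^sup>2"
    using assms by (intro power_mono max.mono) auto
  then have "l / 2 * (max a 0)\<^sup>2 \<le> l / 2 * (max (a + b / l) 0)\<^sup>2"
    using assms by (intro mult_left_mono) auto
  then show ?thesis using assms by (simp add: psi_def field_simps power2_eq_square)
qed

lemma psi_nonpos:
  assumes "l > 0" "b \<ge> 0" "a \<le> 0"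
  shows "psi l a b \<le> 0"
proof -
  have "(max (a + b / l) 0)\<^sup>2 \<le> (b / l)\<^sup>2"
    using assms by (intro power_mono) auto
  then show ?thesis using assms by (simp add: psi_def mult_nonneg_nonpos)
qed

text \<open>The tangent and the quadratic bound enclose the difference quotient within
  \<open>l / 2 * \<bar>h\<bar>\<close> of the claimed derivative. This covers the kink of
  \<open>max\<close> without a case distinction.\<close>

lemma has_real_derivative_psi:
  assumes "l > 0"
  shows "((\<lambda>a. psi l a b) has_real_derivative max (l * a + b) 0) (at a)"
proof -
  define d where "d = max (l * a + b) 0"
  have "norm ((psi l (a + h) b - psi l a b) / h - d) \<le> l / 2 * \<bar>h\<bar>" if "h \<noteq> 0" for h
  proof -
    have "\<bar>psi l (a + h) b - psi l a b - d * h\<bar> \<le> l / 2 * h\<^sup>2"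
      using psi_above_tangent[OF assms, of a b "a + h"] assms
        psi_quadratic_upper_bound[OF assms, of "a + h" b a] by (simp add: d_def abs_le_iff)
    then have "\<bar>psi l (a + h) b - psi l a b - d * h\<bar> / \<bar>h\<bar> \<le> l / 2 * \<bar>h\<bar>"
      using that by (simp add: field_simps power2_eq_square)
    moreover have "(psi l (a + h) b - psi l a b) / h - d = (psi l (a + h) b - psi l a b - d * h) / h"
      using that by (simp add: field_simps)
    ultimately show ?thesis by (simp add: abs_divide)
  qed
  then have "eventually (\<lambda>h. norm ((psi l (a + h) b - psi l a b) / h - d) \<le> l / 2 * \<bar>h\<bar>) (at 0)"
    by (simp add: eventually_at_filter)
  moreover have "((\<lambda>h. l / 2 * \<bar>h\<bar>) \<longlongrightarrow> 0) (at 0)"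
    by (auto intro!: tendsto_eq_intros)
  ultimately have "((\<lambda>h. (psi l (a + h) b - psi l a b) / h - d) \<longlongrightarrow> 0) (at 0)"
    by (rule Lim_null_comparison)
  then show ?thesis unfolding DERIV_def d_def by (simp add: LIM_zero_iff)
qed

text \<open>The variational form \<open>psi l a b = sup {w * a - (w - b)\<^sup>2 / (2 * l) | w. w \<ge> 0}\<close>,
  whose maximizer is \<open>w = max (l * a + b) 0 = b + l * max (- b / l) a\<close>.\<close>

lemma psi_ge_dual:
  assumes "l > 0" "w \<ge> 0"
  shows "w * a - (w - b)\<^sup>2 / (2 * l) \<le> psi l a b"
proof -
  define \<beta> \<omega> m where "\<beta> = b / l" and "\<omega> = w / l" and "m = max (a + \<beta>) 0"
  have bw: "b = l * \<beta>" "w = l * \<omega>" using assms by (simp_all add: \<beta>_def \<omega>_def)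
  have "2 * (a + \<beta>) * \<omega> \<le> 2 * m * \<omega>"
    using assms by (intro mult_right_mono mult_left_mono) (auto simp: m_def \<omega>_def)
  also have "\<dots> \<le> m\<^sup>2 + \<omega>\<^sup>2" by (rule sum_squares_bound)
  finally have "l / 2 * (2 * (a + \<beta>) * \<omega>) \<le> l / 2 * (m\<^sup>2 + \<omega>\<^sup>2)"
    using assms by (intro mult_left_mono) auto
  moreover have "(w - b)\<^sup>2 / (2 * l) = l / 2 * (\<omega> - \<beta>)\<^sup>2"
    using assms unfolding bw by (simp add: power2_eq_square field_simps)
  moreover have "psi l a b = l / 2 * (m\<^sup>2 - \<beta>\<^sup>2)"
    by (simp add: psi_def m_def \<beta>_def)
  ultimately show ?thesis
    unfolding bw(2) by (simp add: power2_eq_square algebra_simps)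
qed

lemma psi_eq_dual:
  fixes a b l :: real
  assumes "l > 0"
  defines "p \<equiv> max (- b / l) a"
  shows "psi l a b = (b + l * p) * a - l * p\<^sup>2 / 2"
proof (cases "a + b / l \<ge> 0")
  case True
  then have "p = a" unfolding p_def using assms by simp
  then show ?thesis using True assms by (simp add: psi_def field_simps power2_eq_square)
next
  case False
  then have "p = - b / l" unfolding p_def using assms by simp
  then show ?thesis using False assms by (simp add: psi_def field_simps power2_eq_square)
qed

text \<open>The maximizer in the variational form for the new parameters is admissible for the old
  ones. Subtracting the two expressions cancels the term linear in \<open>a\<close>, and what
  remains is quadratic in the multiplier steps \<open>p\<close> and \<open>p'\<close>.\<close>

lemma psi_update_le:
  fixes a b s l :: real
  assumes l: "0 < l" "l \<le> l'" "l' \<le> R * l" and s: "0 \<le> s" "s \<le> l" and b: "0 \<le> b"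
  defines "p \<equiv> max (- b / l) a"
  defines "b' \<equiv> b + s * p"
  defines "p' \<equiv> max (- b' / l') a"
  assumes P: "\<bar>p\<bar> \<le> P" "\<bar>p'\<bar> \<le> P"
  shows "psi l' a b' - psi l a b \<le> 2 * R * ((l' - l) + s) * P\<^sup>2"
proof -
  have l': "l' > 0" using l by simp
  have R: "R \<ge> 1" using l by (metis mult_le_cancel_right1 order_trans not_less order.asym)
  \<comment> \<open>\<open>w\<close> attains the supremum for \<open>l'\<close> and
    \<open>b'\<close>, and serves as test value for \<open>l\<close> and \<open>b\<close>.\<close>
  define w where "w = b' + l' * p'"
  have "w \<ge> 0" unfolding w_def p'_def using l' by (simp add: max_def field_simps)
  have p2: "p\<^sup>2 \<le> P\<^sup>2" "p'\<^sup>2 \<le> P\<^sup>2" using P by (simp_all add: abs_le_square_iff[symmetric])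
  have pp: "p * p' \<le> P\<^sup>2"
  proof -
    have "p * p' \<le> \<bar>p\<bar> * \<bar>p'\<bar>" by (metis abs_ge_self abs_mult)
    also have "\<dots> \<le> P * P" using P by (intro mult_mono) auto
    finally show ?thesis by (simp add: power2_eq_square)
  qed
  have "psi l' a b' - psi l a b \<le> (w - b)\<^sup>2 / (2 * l) - l' * p'\<^sup>2 / 2"
    using psi_eq_dual[OF l', of a b'] psi_ge_dual[OF l(1) \<open>w \<ge> 0\<close>, of a b]
    by (simp add: w_def p'_def)
  also have "w - b = s * p + l' * p'" by (simp add: w_def b'_def)
  \<comment> \<open>The coefficients of \<open>p'\<^sup>2\<close> combine to
    \<open>(l' / l) * (l' - l) / 2\<close>, so each term on the right carries a factor
    \<open>l' - l\<close> or \<open>s\<close>.\<close>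
  also have "(s * p + l' * p')\<^sup>2 / (2 * l) - l' * p'\<^sup>2 / 2
      = (l' / l) * (l' - l) / 2 * p'\<^sup>2 + (l' / l) * s * (p * p') + s * (s / l) / 2 * p\<^sup>2"
    using l by (simp add: field_simps power2_eq_square)
  also have "\<dots> \<le> R * (l' - l) / 2 * P\<^sup>2 + R * s * P\<^sup>2 + s * 1 / 2 * P\<^sup>2"
  proof (intro add_mono)
    have q: "l' / l \<le> R" using l by (simp add: field_simps)
    show "(l' / l) * (l' - l) / 2 * p'\<^sup>2 \<le> R * (l' - l) / 2 * P\<^sup>2"
      using q l R p2 by (intro mult_mono divide_right_mono) auto
    have "(l' / l) * s * (p * p') \<le> (l' / l) * s * P\<^sup>2"
      using pp l s by (intro mult_left_mono) auto
    also have "\<dots> \<le> R * s * P\<^sup>2"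
      using q s by (intro mult_right_mono) auto
    finally show "(l' / l) * s * (p * p') \<le> R * s * P\<^sup>2" .
    show "s * (s / l) / 2 * p\<^sup>2 \<le> s * 1 / 2 * P\<^sup>2"
      using l s p2 by (intro mult_mono divide_right_mono) auto
  qed
  also have "\<dots> \<le> 2 * R * ((l' - l) + s) * P\<^sup>2"
  proof -
    have "R * (l' - l) / 2 + R * s + s / 2 \<le> 2 * R * ((l' - l) + s)"
    proof -
      have "s \<le> R * s" "0 \<le> R * (l' - l)" using R s l by (auto simp: mult_le_cancel_right1)
      moreover have "2 * R * ((l' - l) + s) = 2 * (R * (l' - l)) + 2 * (R * s)"
        by (simp add: algebra_simps)
      ultimately show ?thesis using s by linarith
    qed
    from mult_right_mono[OF this, of "P\<^sup>2"] show ?thesis by (simp add: algebra_simps)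
  qed
  finally show ?thesis .
qed

section \<open>Short steps and the rate recursion\<close>

text \<open>For \<open>n > 0\<close> the short step maximizes the concave quadratic on the right
  over the unit interval. If the cap 1 is active, at least half of \<open>G\<close> is gained;
  otherwise the gain is \<open>G\<^sup>2 / (2 * L * n\<^sup>2)\<close>, and the assumed bound on
  \<open>n\<^sup>2\<close> turns this into a power of \<open>G\<close>.\<close>

lemma short_step_decrease:
  fixes G L n \<alpha> :: real
  assumes "G \<ge> 0" "L > 0" "n \<ge> 0" "n = 0 \<Longrightarrow> G = 0"
    and \<alpha>: "\<alpha> = (if G = 0 \<and> n = 0 then 0 else min 1 (G / (L * n\<^sup>2)))"
  shows "0 \<le> \<alpha> * G - \<alpha>\<^sup>2 / 2 * L * n\<^sup>2"
    and "\<lbrakk>G > 0; A > 0; n\<^sup>2 \<le> A * G powr (1 - \<mu>)\<rbrakk> \<Longrightarrow>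
      min (G / 2) (G powr (1 + \<mu>) / (2 * L * A)) \<le> \<alpha> * G - \<alpha>\<^sup>2 / 2 * L * n\<^sup>2"
proof -
  have key: "min (G / 2) (G\<^sup>2 / (2 * L * n\<^sup>2)) \<le> \<alpha> * G - \<alpha>\<^sup>2 / 2 * L * n\<^sup>2" if "n > 0"
  proof (cases "G \<ge> L * n\<^sup>2")
    case True
    then have "\<alpha> = 1" using that assms by (simp add: min_def divide_le_eq)
    then show ?thesis using True by simp
  next
    case False
    then have \<alpha>': "\<alpha> = G / (L * n\<^sup>2)" using that assms by (simp add: min_def divide_le_eq)
    then have G: "\<alpha> * (L * n\<^sup>2) = G" using that assms(2) by simp
    have "\<alpha>\<^sup>2 / 2 * L * n\<^sup>2 = \<alpha> * (\<alpha> * (L * n\<^sup>2)) / 2" by (simp add: power2_eq_square)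
    then have "\<alpha> * G - \<alpha>\<^sup>2 / 2 * L * n\<^sup>2 = \<alpha> * G / 2" unfolding G by simp
    also have "\<dots> = G\<^sup>2 / (2 * L * n\<^sup>2)" by (simp add: \<alpha>' power2_eq_square)
    finally show ?thesis by simp
  qed
  show "0 \<le> \<alpha> * G - \<alpha>\<^sup>2 / 2 * L * n\<^sup>2"
  proof (cases "n > 0")
    case True
    have "0 \<le> min (G / 2) (G\<^sup>2 / (2 * L * n\<^sup>2))" using assms by simp
    with key[OF True] show ?thesis by linarith
  qed (use assms in auto)
  assume G: "G > 0" and A: "A > 0" and n: "n\<^sup>2 \<le> A * G powr (1 - \<mu>)"
  then have "n > 0" using assms by fastforce
  have "G powr (1 + \<mu>) = G\<^sup>2 / G powr (1 - \<mu>)"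
    using G powr_diff[of G 2 "1 - \<mu>"] by simp
  then have "G powr (1 + \<mu>) / (2 * L * A) = G\<^sup>2 / (2 * L * (A * G powr (1 - \<mu>)))"
    by simp
  also have "\<dots> \<le> G\<^sup>2 / (2 * L * n\<^sup>2)"
    using n \<open>n > 0\<close> assms(2) A G by (intro divide_left_mono mult_left_mono mult_pos_pos) auto
  finally show "min (G / 2) (G powr (1 + \<mu>) / (2 * L * A)) \<le> \<alpha> * G - \<alpha>\<^sup>2 / 2 * L * n\<^sup>2"
    using key[OF \<open>n > 0\<close>] by linarith
qed

section \<open>Polynomial rates from scalar recursions\<close>

lemma eventually_powr_le:
  fixes a b A \<epsilon> :: real
  assumes "a < b" "\<epsilon> > 0"
  shows "\<forall>\<^sub>F k in sequentially. A * real k powr a \<le> \<epsilon> * real k powr b"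
proof -
  have "(\<lambda>k. real k powr (a - b)) \<longlonglongrightarrow> 0"
    using assms by (intro tendsto_neg_powr filterlim_real_sequentially) auto
  then have "(\<lambda>k. A * real k powr (a - b)) \<longlonglongrightarrow> A * 0" by (intro tendsto_intros)
  then have "\<forall>\<^sub>F k in sequentially. A * real k powr (a - b) < \<epsilon>"
    using order_tendstoD(2)[of _ 0] assms(2) by fastforce
  then show ?thesis using eventually_gt_at_top[of 0]
  proof eventually_elim
    case (elim k)
    then have "A * real k powr (a - b) * real k powr b \<le> \<epsilon> * real k powr b"
      by (intro mult_right_mono) auto
    moreover have "real k powr (a - b) * real k powr b = real k powr a"
      by (simp add: powr_add[symmetric])
    ultimately show ?case by (simp add: mult.assoc)
  qed
qed

text \<open>For exponents at most 1, \<open>(1 + 1 / k) powr \<rho>\<close> is at most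
  \<open>1 + 1 / k\<close>, and the product of \<open>1 + 1 / k\<close> and \<open>1 - 1 / k\<close>
  is at most 1. The result limits how fast the comparison sequence of the next induction can
  fall.\<close>

lemma powr_Suc_ge:
  assumes "0 \<le> \<rho>" "\<rho> \<le> 1" "k > 0"
  shows "real k powr (- \<rho>) - real k powr (- \<rho> - 1) \<le> real (Suc k) powr (- \<rho>)"
proof -
  have "real (Suc k) = real k * (1 + 1 / real k)" using assms by (simp add: field_simps)
  then have "real (Suc k) powr \<rho> = real k powr \<rho> * (1 + 1 / real k) powr \<rho>"
    by (simp only: powr_mult)
  also have "\<dots> \<le> real k powr \<rho> * (1 + 1 / real k) powr 1"
    using assms by (intro mult_left_mono powr_mono) auto
  finally have "real (Suc k) powr \<rho> * (1 - 1 / real k)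
      \<le> real k powr \<rho> * (1 + 1 / real k) * (1 - 1 / real k)"
    using assms by (intro mult_right_mono) auto
  also have "\<dots> = real k powr \<rho> * (1 - (1 / real k)\<^sup>2)"
    using assms by (simp add: power2_eq_square field_simps)
  also have "\<dots> \<le> real k powr \<rho> * 1" by (intro mult_left_mono) auto
  finally have "(1 - 1 / real k) / real k powr \<rho> \<le> 1 / real (Suc k) powr \<rho>"
    using assms by (simp add: pos_divide_le_eq pos_le_divide_eq mult.commute del: of_nat_Suc)
  then show ?thesis
    using assms by (simp add: powr_minus powr_diff field_simps del: of_nat_Suc)
qed

text \<open>Induction against \<open>M * real k powr (- \<rho>)\<close>. The condition
  \<open>\<rho> * (1 + \<mu>) \<le> 1\<close> lets the decrease absorb the forcing term of order
  \<open>-1 - \<tau>\<close>; the strict condition \<open>\<rho> * \<mu> + \<tau> < 1\<close> lets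
  it absorb both \<open>C * T k / k\<close> and the fall of the comparison sequence.\<close>

lemma recursion_rate:
  fixes T :: "nat \<Rightarrow> real" and c C \<mu> \<tau> \<rho> :: real
  assumes nonneg: "\<And>k. 0 \<le> T k" and "c > 0" "C > 0" "0 \<le> \<mu>"
    and \<rho>: "0 \<le> \<rho>" "\<rho> \<le> 1" "\<rho> * (1 + \<mu>) \<le> 1" "\<rho> * \<mu> + \<tau> < 1" and "0 < \<tau>"
    and rec: "\<forall>\<^sub>F k in sequentially. T (Suc k) \<le> T k
      - min (T k / 2) (c * T k powr (1 + \<mu>) * real k powr (- \<tau>))
      + C * real k powr (- 1 - \<tau>) + C * T k / real k"
  shows "\<exists>M>0. \<forall>\<^sub>F k in sequentially. T k \<le> M * real k powr (- \<rho>)"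
proof -
  have "\<forall>\<^sub>F k in sequentially. C * real k powr (- 1 - \<tau>) \<le> 1 / 16 * real k powr (- \<rho>)"
    using \<rho> \<open>0 < \<tau>\<close> by (intro eventually_powr_le) auto
  moreover have "\<forall>\<^sub>F k in sequentially. (C + 1) * real k powr (- \<rho> - 1) \<le> 1 / 16 * real k powr (- \<rho>)"
    by (intro eventually_powr_le) auto
  \<comment> \<open>At half the comparison value, the decrease is at least \<open>2 * M\<close>
    times the right-hand side here. One half pays for these terms, the other for the forcing
    term.\<close>
  moreover have "\<forall>\<^sub>F k in sequentially. (C + 1) * real k powr (- \<rho> - 1)
      \<le> c / 2 powr (2 + \<mu>) * real k powr (- \<rho> * (1 + \<mu>) - \<tau>)"
    using assms by (intro eventually_powr_le) (auto simp: algebra_simps)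
  ultimately have "\<forall>\<^sub>F k in sequentially. k > 0 \<and>
      C * real k powr (- 1 - \<tau>) \<le> 1 / 16 * real k powr (- \<rho>) \<and>
      (C + 1) * real k powr (- \<rho> - 1) \<le> 1 / 16 * real k powr (- \<rho>) \<and>
      (C + 1) * real k powr (- \<rho> - 1) \<le> c / 2 powr (2 + \<mu>) * real k powr (- \<rho> * (1 + \<mu>) - \<tau>) \<and>
      T (Suc k) \<le> T k - min (T k / 2) (c * T k powr (1 + \<mu>) * real k powr (- \<tau>))
        + C * real k powr (- 1 - \<tau>) + C * T k / real k"
    using rec eventually_gt_at_top[of 0] by eventually_elim blast
  then obtain K where "\<And>k. k \<ge> K \<Longrightarrow> k > 0 \<and>
      C * real k powr (- 1 - \<tau>) \<le> 1 / 16 * real k powr (- \<rho>) \<and>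
      (C + 1) * real k powr (- \<rho> - 1) \<le> 1 / 16 * real k powr (- \<rho>) \<and>
      (C + 1) * real k powr (- \<rho> - 1) \<le> c / 2 powr (2 + \<mu>) * real k powr (- \<rho> * (1 + \<mu>) - \<tau>) \<and>
      T (Suc k) \<le> T k - min (T k / 2) (c * T k powr (1 + \<mu>) * real k powr (- \<tau>))
        + C * real k powr (- 1 - \<tau>) + C * T k / real k"
    unfolding eventually_sequentially by blast
  note K = this
  then have "K > 0" by blast
  \<comment> \<open>The three entries give \<open>M \<le> M powr (1 + \<mu>)\<close>, the base case
    at \<open>K\<close>, and domination of \<open>C\<close> by half of the available
    decrease.\<close>
  define M where "M = max 1 (max (T K * real K powr \<rho>) (C * 2 powr (2 + \<mu>) / c))"
  have M: "M \<ge> 1" "T K * real K powr \<rho> \<le> M" "C * 2 powr (2 + \<mu>) / c \<le> M"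
    by (auto simp: M_def)
  have MC: "C \<le> c / 2 powr (2 + \<mu>) * M"
    using M(3) \<open>c > 0\<close> by (simp add: field_simps)
  have "T k \<le> M * real k powr (- \<rho>)" if "k \<ge> K" for k
    using that
  proof (induction k rule: dec_induct)
    case base
    then show ?case using M(2) \<open>K > 0\<close> by (simp add: powr_minus field_simps)
  next
    case (step k)
    then have "k > 0" using K by blast
    define b e d where "b = real k powr (- \<rho>)" and "e = real k powr (- \<rho> - 1)"
      and "d = real k powr (- \<rho> * (1 + \<mu>) - \<tau>)"
    define D where "D = min (T k / 2) (c * T k powr (1 + \<mu>) * real k powr (- \<tau>))"
    have k1: "C * real k powr (- 1 - \<tau>) \<le> b / 16" "(C + 1) * e \<le> b / 16"
      "(C + 1) * e \<le> c / 2 powr (2 + \<mu>) * d"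
      "T (Suc k) \<le> T k - D + C * real k powr (- 1 - \<tau>) + C * T k / real k"
      using K[OF \<open>K \<le> k\<close>] by (simp_all add: b_def d_def e_def D_def)
    have pos: "b > 0" "e > 0" "d > 0" using \<open>k > 0\<close> by (simp_all add: b_def e_def d_def)
    have Tk: "T k \<le> M * b" using step by (simp add: b_def)
    have be: "b / real k = e" using \<open>k > 0\<close> by (simp add: b_def e_def powr_diff)
    have "C * T k / real k \<le> C * (M * b) / real k"
      using Tk \<open>C > 0\<close> by (intro divide_right_mono mult_left_mono) auto
    also have "\<dots> = M * (C * e)" by (simp add: be[symmetric])
    finally have CT: "C * T k / real k \<le> M * (C * e)" .
    have "D \<ge> 0" using nonneg[of k] \<open>c > 0\<close> by (simp add: D_def)
    have next_b: "M * (b - e) \<le> M * real (Suc k) powr (- \<rho>)"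
      unfolding b_def e_def using powr_Suc_ge[OF \<rho>(1,2) \<open>k > 0\<close>] M(1) by (intro mult_left_mono) auto
    have e1: "M * ((C + 1) * e) \<le> M * (b / 16)"
      using k1(2) M(1) by (intro mult_left_mono) auto
    have b1: "b \<le> M * b" using M(1) pos by simp
    have "T (Suc k) \<le> M * (b - e)"
    \<comment> \<open>Below half of the bound, the perturbations fit into the remaining gap and
      \<open>D\<close> may be dropped. Above it, \<open>D\<close> must cover the perturbations and
      the fall \<open>M * e\<close>.\<close>
    proof (cases "T k \<le> M * b / 2")
      case True
      have expand: "M * ((C + 1) * e) = M * (C * e) + M * e" "M * (b - e) = M * b - M * e"
        by (simp_all add: distrib_left distrib_right right_diff_distrib)
      show ?thesis unfolding expand(2)
        using True e1[unfolded expand(1)] k1(1,4) CT \<open>D \<ge> 0\<close> e1 b1 pos by linarith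
    next
      case False
      then have T2: "T k \<ge> M * b / 2" by simp
      have "M * ((C + 1) * e) + C * real k powr (- 1 - \<tau>) \<le> D"
        unfolding D_def
      proof (rule min.boundedI)
        show "M * ((C + 1) * e) + C * real k powr (- 1 - \<tau>) \<le> T k / 2"
          using k1(1) e1 b1 T2 pos by linarith
        have "- \<rho> * (1 + \<mu>) - \<tau> \<ge> - 1 - \<tau>" using \<rho> by simp
        then have "real k powr (- 1 - \<tau>) \<le> d"
          unfolding d_def using \<open>k > 0\<close> by (intro powr_mono) auto
        then have "C * real k powr (- 1 - \<tau>) \<le> C * d" using \<open>C > 0\<close> by simp
        also have "\<dots> \<le> c / 2 powr (2 + \<mu>) * M * d"
          using MC pos by (intro mult_right_mono) auto
        finally have "C * real k powr (- 1 - \<tau>) \<le> c / 2 powr (2 + \<mu>) * M * d" .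
        moreover have "M * ((C + 1) * e) \<le> M * (c / 2 powr (2 + \<mu>) * d)"
          using k1(3) M(1) by (intro mult_left_mono) auto
        ultimately have "M * ((C + 1) * e) + C * real k powr (- 1 - \<tau>)
            \<le> c / 2 powr (2 + \<mu>) * M * d + M * (c / 2 powr (2 + \<mu>) * d)" by linarith
        also have "\<dots> = 2 * (c / 2 powr (2 + \<mu>)) * M * d" by simp
        also have "2 * (c / 2 powr (2 + \<mu>)) = c / 2 powr (1 + \<mu>)"
          by (simp add: powr_add)
        also have "c / 2 powr (1 + \<mu>) * M * d \<le> c / 2 powr (1 + \<mu>) * M powr (1 + \<mu>) * d"
        proof -
          have "M powr 1 \<le> M powr (1 + \<mu>)" using M(1) \<open>0 \<le> \<mu>\<close> by (intro powr_mono) auto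
          then show ?thesis using M(1) pos \<open>c > 0\<close> by (intro mult_right_mono mult_left_mono) auto
        qed
        also have "\<dots> = c * (M * b / 2) powr (1 + \<mu>) * real k powr (- \<tau>)"
        proof -
          have "d = b powr (1 + \<mu>) * real k powr (- \<tau>)"
            by (simp add: b_def d_def powr_powr powr_add[symmetric])
          then show ?thesis using M(1) pos by (simp add: powr_divide powr_mult)
        qed
        also have "\<dots> \<le> c * T k powr (1 + \<mu>) * real k powr (- \<tau>)"
          using T2 M(1) pos \<open>c > 0\<close> \<open>0 \<le> \<mu>\<close>
          by (intro mult_right_mono mult_left_mono powr_mono2) auto
        finally show "M * ((C + 1) * e) + C * real k powr (- 1 - \<tau>)
            \<le> c * T k powr (1 + \<mu>) * real k powr (- \<tau>)" .
      qed
      then show ?thesis using k1(4) CT Tk by (simp add: algebra_simps)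
    qed
    then show ?case using next_b by simp
  qed
  then show ?thesis
    using M(1) by (intro exI[of _ M] conjI) (auto simp: eventually_sequentially)
qed

section \<open>Frank--Wolfe steps on the augmented Lagrangian\<close>

text \<open>Closed form of \<open>grad_F\<close>. Its coefficients are the shifted multipliers that
  are later tested for membership in \<open>approx_compl_set\<close>.\<close>

definition al_grad ::
  "(real^'n \<Rightarrow> real) \<Rightarrow> (real^'n \<Rightarrow> real^'m) \<Rightarrow> real \<Rightarrow> real^'n \<Rightarrow> real^'m \<Rightarrow> real^'n" where
  "al_grad f g l y w =
    grad f y + (\<Sum>i\<in>UNIV. max (l * g y $ i + w $ i) 0 *\<^sub>R grad (\<lambda>y. g y $ i) y)"

lemma grad_F_eq_al_grad:
  assumes "f differentiable (at y)" "\<And>i. (\<lambda>y. g y $ i) differentiable (at y)" "l > 0"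
  shows "grad_F f g l y w = al_grad f g l y w"
proof -
  have "((\<lambda>y. psi l (g y $ i) (w $ i)) has_derivative
      (\<lambda>h. h \<bullet> (max (l * g y $ i + w $ i) 0 *\<^sub>R grad (\<lambda>y. g y $ i) y))) (at y)" for i
  proof -
    have "((\<lambda>a. psi l a (w $ i)) has_derivative (\<lambda>s. max (l * g y $ i + w $ i) 0 * s)) (at (g y $ i))"
      using has_real_derivative_psi[OF assms(3)] by (simp add: has_field_derivative_def)
    from has_derivative_compose[OF GDERIV_grad[OF assms(2)[of i], unfolded gderiv_def] this]
    show ?thesis by simp
  qed
  then have "((\<lambda>y. f y + (\<Sum>i\<in>UNIV. psi l (g y $ i) (w $ i))) has_derivative
      (\<lambda>h. h \<bullet> grad f y + (\<Sum>i\<in>UNIV. h \<bullet> (max (l * g y $ i + w $ i) 0 *\<^sub>R grad (\<lambda>y. g y $ i) y)))) (at y)"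
    using GDERIV_grad[OF assms(1), unfolded gderiv_def] by (intro has_derivative_add has_derivative_sum)
  then have "GDERIV (\<lambda>y. F_AL f g l y w) y :> al_grad f g l y w"
    by (simp add: gderiv_def F_AL_def Psi_eq_sum_psi al_grad_def inner_add_right inner_sum_right)
  then show ?thesis by (simp add: grad_F_def grad_eq)
qed

lemma al_grad_inner:
  "al_grad f g l y w \<bullet> d =
    grad f y \<bullet> d + (\<Sum>i\<in>UNIV. max (l * g y $ i + w $ i) 0 * (grad (\<lambda>y. g y $ i) y \<bullet> d))"
  by (simp add: al_grad_def inner_add_left inner_sum_left)

text \<open>A run expressed on the set \<open>C\<close>, with explicit gradients and gaps. The KKT
  point enters through \<open>exact_penalty\<close>: over \<open>C\<close>, \<open>xs\<close>
  minimizes \<open>f\<close> plus \<open>\<zeta>\<close> times the total constraint violation, up to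
  its own zero violation.\<close>

locale al_frank_wolfe =
  fixes f :: "real^'n \<Rightarrow> real" and g :: "real^'n \<Rightarrow> real^'m" and C :: "(real^'n) set"
    and Lf :: real and Lg B :: "real^'m"
    and lam sig \<alpha> :: "nat \<Rightarrow> real" and x v :: "nat \<Rightarrow> real^'n" and z :: "nat \<Rightarrow> real^'m"
    and xs :: "real^'n" and \<zeta> :: real
  assumes f_convex: "convex_on UNIV f" and f_diff: "\<And>y. f differentiable (at y)" and Lf_pos: "Lf > 0"
    and f_lip: "\<And>y y'. \<lbrakk>y \<in> C; y' \<in> C\<rbrakk> \<Longrightarrow> norm (grad f y - grad f y') \<le> Lf * norm (y - y')"
    and g_convex: "\<And>i. convex_on UNIV (\<lambda>y. g y $ i)"
    and g_diff: "\<And>i y. (\<lambda>y. g y $ i) differentiable (at y)" and Lg_pos: "\<And>i. Lg $ i > 0"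
    and g_lip: "\<And>i y y'. \<lbrakk>y \<in> C; y' \<in> C\<rbrakk> \<Longrightarrow>
      norm (grad (\<lambda>y. g y $ i) y - grad (\<lambda>y. g y $ i) y') \<le> Lg $ i * norm (y - y')"
    and g_bound: "\<And>i y y'. \<lbrakk>y \<in> C; y' \<in> C\<rbrakk> \<Longrightarrow> \<bar>g y $ i - g y' $ i\<bar> \<le> B $ i * norm (y - y')"
    and C_convex: "convex C" and C_bounded: "bounded C"
    and xs_in: "xs \<in> C" and xs_feas: "\<And>i. g xs $ i \<le> 0" and \<zeta>: "\<zeta> \<ge> 0"
    and exact_penalty: "\<And>y. y \<in> C \<Longrightarrow> f xs \<le> f y + \<zeta> * (\<Sum>i\<in>UNIV. max (g y $ i) 0)"
    and x_0: "x 0 \<in> C" and z_0: "\<And>i. z 0 $ i \<ge> 0"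
    and lam_pos: "\<And>k. 0 < lam k" and lam_less: "\<And>k. lam k < lam (Suc k)"
    and lam_top: "filterlim lam at_top sequentially"
    and sig_pos: "\<And>k. 0 < sig k" and sig_le: "\<And>k. sig k \<le> lam k" and sig_summable: "summable sig"
    and v_in: "\<And>k. v k \<in> C"
    and v_min: "\<And>k y. y \<in> C \<Longrightarrow>
      v k \<bullet> al_grad f g (lam k) (x k) (z k) \<le> y \<bullet> al_grad f g (lam k) (x k) (z k)"
    and \<alpha>_range: "\<And>k. \<alpha> k \<in> {0..1}"
    and x_Suc: "\<And>k. x (Suc k) = x k + \<alpha> k *\<^sub>R (v k - x k)"
    and z_Suc: "\<And>k. z (Suc k) = z k + sig k *\<^sub>R (\<chi> i. max (- (z k $ i) / lam k) (g (x (Suc k)) $ i))"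
    and \<alpha>_short: "\<And>k. \<alpha> k =
      (let G = al_grad f g (lam k) (x k) (z k) \<bullet> (x k - v k)
       in if G = 0 \<and> norm (v k - x k) = 0 then 0
          else min 1 (G / ((L_Psi g B Lg (lam k) (x k) (z k) + Lf) * (norm (v k - x k))\<^sup>2)))"
begin

section \<open>Quantities of a run and their elementary bounds\<close>

definition "u k = al_grad f g (lam k) (x k) (z k)"
definition "G k = u k \<bullet> (x k - v k)"
definition "L k = L_Psi g B Lg (lam k) (x k) (z k) + Lf"
definition "excess k = F_AL f g (lam k) (x k) (z k) - f xs"
definition "decrease k = \<alpha> k * G k - (\<alpha> k)\<^sup>2 / 2 * L k * (norm (v k - x k))\<^sup>2"

lemma x_in: "x k \<in> C"
  using C_convex x_0 v_in \<alpha>_range x_Suc by (rule convex_iterates_in)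

text \<open>The condition \<open>sig k \<le> lam k\<close> ensures that even the most negative
  update removes at most the current multiplier.\<close>

lemma z_nonneg: "0 \<le> z k $ i"
proof (induction k)
  case (Suc k)
  have "- (z k $ i) \<le> sig k * (- (z k $ i) / lam k)"
    using mult_right_mono[OF sig_le[of k] Suc] lam_pos[of k] by (simp add: field_simps)
  also have "\<dots> \<le> sig k * max (- (z k $ i) / lam k) (g (x (Suc k)) $ i)"
    using sig_pos[of k] by (intro mult_left_mono) auto
  finally show ?case by (simp add: z_Suc)
qed (rule z_0)

lemma lam_ge_0: "lam 0 \<le> lam k"
  using lift_Suc_mono_le[of lam 0 k] lam_less by (simp add: less_imp_le)

lemma g_bounded: "\<exists>Gb>0. \<forall>y\<in>C. \<forall>i. \<bar>g y $ i\<bar> \<le> Gb"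
proof -
  obtain D where D: "\<And>y. y \<in> C \<Longrightarrow> norm (y - xs) \<le> D"
    using C_bounded by (metis bounded_any_center dist_norm norm_minus_commute)
  have "0 \<le> D" using D[OF xs_in] by simp
  define Gb where "Gb = 1 + (\<Sum>i\<in>UNIV. \<bar>g xs $ i\<bar> + \<bar>B $ i\<bar> * D)"
  have "\<bar>g y $ i\<bar> \<le> Gb" if "y \<in> C" for y i
  proof -
    have "\<bar>g y $ i\<bar> \<le> \<bar>g xs $ i\<bar> + B $ i * norm (y - xs)"
      using g_bound[OF that xs_in, of i] by linarith
    also have "B $ i * norm (y - xs) \<le> \<bar>B $ i\<bar> * D"
      using D[OF that] by (intro mult_mono) auto
    also have "\<bar>g xs $ i\<bar> + \<bar>B $ i\<bar> * D \<le> (\<Sum>i\<in>UNIV. \<bar>g xs $ i\<bar> + \<bar>B $ i\<bar> * D)"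
      using \<open>0 \<le> D\<close> by (intro member_le_sum) auto
    finally show ?thesis by (simp add: Gb_def)
  qed
  moreover have "Gb > 0"
    unfolding Gb_def using \<open>0 \<le> D\<close> by (intro add_pos_nonneg sum_nonneg) auto
  ultimately show ?thesis by blast
qed

text \<open>Each update adds at most \<open>Gb * sig k\<close>, because the constraints are bounded
  on \<open>C\<close>; summability of \<open>sig\<close> makes the accumulated bound uniform in
  \<open>k\<close>.\<close>

lemma z_bounded: "\<exists>Z>0. \<forall>k i. z k $ i \<le> Z"
proof -
  obtain Gb where Gb: "Gb > 0" "\<And>y i. y \<in> C \<Longrightarrow> \<bar>g y $ i\<bar> \<le> Gb" using g_bounded by blast
  have "z k $ i \<le> z 0 $ i + Gb * (\<Sum>j<k. sig j)" for k i
  proof (induction k)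
    case (Suc k)
    have "- (z k $ i) / lam k \<le> 0" using z_nonneg[of k i] lam_pos[of k] by simp
    then have "max (- (z k $ i) / lam k) (g (x (Suc k)) $ i) \<le> Gb"
      using Gb(1) Gb(2)[OF x_in[of "Suc k"], of i] by simp
    then have "sig k * max (- (z k $ i) / lam k) (g (x (Suc k)) $ i) \<le> sig k * Gb"
      using sig_pos[of k] by (intro mult_left_mono) auto
    then show ?case using Suc unfolding z_Suc by (simp add: algebra_simps)
  qed simp
  also have "z 0 $ i + Gb * (\<Sum>j<k. sig j) \<le> 1 + (\<Sum>i\<in>UNIV. z 0 $ i) + Gb * suminf sig" for k i
  proof (intro add_mono mult_left_mono)
    have "z 0 $ i \<le> (\<Sum>i\<in>UNIV. z 0 $ i)" using z_0 by (intro member_le_sum) auto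
    then show "z 0 $ i \<le> 1 + (\<Sum>i\<in>UNIV. z 0 $ i)" by simp
    show "sum sig {..<k} \<le> suminf sig"
      using sig_summable sig_pos by (intro sum_le_suminf) (auto simp: less_imp_le)
  qed (use Gb in auto)
  finally have "z k $ i \<le> 1 + (\<Sum>i\<in>UNIV. z 0 $ i) + Gb * suminf sig" for k i .
  moreover have "0 < 1 + (\<Sum>i\<in>UNIV. z 0 $ i) + Gb * suminf sig"
    using Gb z_0 sig_summable sig_pos
    by (intro add_pos_nonneg mult_nonneg_nonneg suminf_nonneg sum_nonneg) (auto simp: less_imp_le)
  ultimately show ?thesis by blast
qed

text \<open>At the feasible point \<open>xs\<close> every \<open>psi\<close> is nonpositive, so
  convexity bounds the excess by the linearization at \<open>x k\<close> in the direction from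
  \<open>xs\<close>. Replacing \<open>xs\<close> by the linear minimizer \<open>v k\<close> can only
  increase it.\<close>

lemma excess_le_G: "excess k \<le> G k"
proof -
  let ?d = "x k - xs" and ?w = "\<lambda>i. max (lam k * g (x k) $ i + z k $ i) 0"
  have "f (x k) - f xs \<le> grad f (x k) \<bullet> ?d"
    using convex_on_imp_above_grad[OF f_convex f_diff, of "x k" xs] by (simp add: inner_diff_right)
  moreover have "(\<Sum>i\<in>UNIV. psi (lam k) (g (x k) $ i) (z k $ i))
      \<le> (\<Sum>i\<in>UNIV. ?w i * (grad (\<lambda>y. g y $ i) (x k) \<bullet> ?d))"
  proof (rule sum_mono)
    fix i
    have "psi (lam k) (g (x k) $ i) (z k $ i) + ?w i * (g xs $ i - g (x k) $ i) \<le> 0"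
      using psi_above_tangent[OF lam_pos, of k "g (x k) $ i" "z k $ i" "g xs $ i"]
        psi_nonpos[OF lam_pos[of k] z_nonneg[of k i] xs_feas[of i]] by linarith
    moreover have "?w i * (g (x k) $ i - g xs $ i) \<le> ?w i * (grad (\<lambda>y. g y $ i) (x k) \<bullet> ?d)"
      using convex_on_imp_above_grad[OF g_convex[of i] g_diff, of "x k" xs]
      by (intro mult_left_mono) (auto simp: inner_diff_right)
    ultimately show "psi (lam k) (g (x k) $ i) (z k $ i) \<le> ?w i * (grad (\<lambda>y. g y $ i) (x k) \<bullet> ?d)"
      by (simp add: algebra_simps)
  qed
  ultimately have "excess k \<le> u k \<bullet> (x k - xs)"
    by (simp add: excess_def F_AL_def Psi_eq_sum_psi u_def al_grad_inner)
  also have "\<dots> \<le> G k"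
    using v_min[OF xs_in, of k] unfolding G_def u_def inner_diff_right by (simp add: inner_commute)
  finally show ?thesis .
qed

lemma G_nonneg: "0 \<le> G k"
  using v_min[OF x_in[of k], of k] unfolding G_def u_def inner_diff_right by (simp add: inner_commute)

lemma L_pos: "0 < L k"
proof -
  have "0 \<le> L_Psi g B Lg (lam k) (x k) (z k)"
    unfolding L_Psi_def using lam_pos[of k] Lg_pos
    by (intro sum_nonneg add_nonneg_nonneg mult_nonneg_nonneg) (auto simp: less_imp_le)
  then show ?thesis using Lf_pos by (simp add: L_def)
qed

text \<open>Constraint values and multipliers are bounded, so \<open>L\<close> grows at most
  affinely in \<open>lam k\<close>; since \<open>lam 0 \<le> lam k\<close>, constants are absorbed
  into the linear term.\<close>

lemma L_le: "\<exists>M>0. \<forall>k. L k \<le> M * lam k"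
proof -
  obtain Gb where Gb: "Gb > 0" "\<And>y i. y \<in> C \<Longrightarrow> \<bar>g y $ i\<bar> \<le> Gb" using g_bounded by blast
  obtain Z where Z: "Z > 0" "\<And>k i. z k $ i \<le> Z" using z_bounded by blast
  define M where "M = (\<Sum>i\<in>UNIV. (B $ i)\<^sup>2 + Lg $ i * (Gb + Z / lam 0)) + Lf / lam 0"
  have scale: "a \<le> a / lam 0 * lam k" if "a \<ge> 0" for a k
    using mult_left_mono[OF lam_ge_0[of k] that] lam_pos[of 0] by (simp add: field_simps)
  have "L k \<le> M * lam k" for k
  proof -
    have "lam k * (B $ i)\<^sup>2 + Lg $ i * max (lam k * g (x k) $ i + z k $ i) 0
        \<le> ((B $ i)\<^sup>2 + Lg $ i * (Gb + Z / lam 0)) * lam k" for i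
    proof -
      have "lam k * g (x k) $ i \<le> lam k * Gb"
        using Gb(2)[OF x_in, of k i] lam_pos[of k] by (intro mult_left_mono) auto
      moreover have "z k $ i \<le> Z / lam 0 * lam k" using Z scale[of Z k] by (meson less_imp_le order_trans)
      ultimately have "lam k * g (x k) $ i + z k $ i \<le> (Gb + Z / lam 0) * lam k"
        unfolding distrib_right mult.commute[of Gb] by (rule add_mono)
      moreover have "0 \<le> (Gb + Z / lam 0) * lam k"
        using Gb(1) Z(1) lam_pos[of 0] lam_pos[of k] by simp
      ultimately have "max (lam k * g (x k) $ i + z k $ i) 0 \<le> (Gb + Z / lam 0) * lam k"
        by simp
      then have "Lg $ i * max (lam k * g (x k) $ i + z k $ i) 0 \<le> Lg $ i * ((Gb + Z / lam 0) * lam k)"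
        using Lg_pos[of i] by (intro mult_left_mono) auto
      then show ?thesis by (simp add: algebra_simps)
    qed
    then have "L_Psi g B Lg (lam k) (x k) (z k)
        \<le> (\<Sum>i\<in>UNIV. (B $ i)\<^sup>2 + Lg $ i * (Gb + Z / lam 0)) * lam k"
      unfolding L_Psi_def sum_distrib_right by (intro sum_mono)
    then show ?thesis using scale[of Lf k] Lf_pos by (simp add: L_def M_def distrib_right)
  qed
  moreover have "M > 0"
    unfolding M_def using Lf_pos lam_pos[of 0] Gb Z Lg_pos
    by (intro add_nonneg_pos sum_nonneg add_nonneg_nonneg mult_nonneg_nonneg)
       (auto simp: less_imp_le)
  ultimately show ?thesis by blast
qed

text \<open>The curvature is that at \<open>x k\<close> only: \<open>psi\<close> contributes
  \<open>lam k\<close> times the squared Lipschitz constant of the constraint, and the curvature of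
  the constraint is weighted by the derivative of \<open>psi\<close> at the current point. Their sum
  is \<open>L_Psi\<close>.\<close>

lemma sufficient_decrease:
  "F_AL f g (lam k) (x (Suc k)) (z k) \<le> F_AL f g (lam k) (x k) (z k) - decrease k"
proof -
  let ?y = "x (Suc k)"
  define d where "d = ?y - x k"
  let ?w = "\<lambda>i. max (lam k * g (x k) $ i + z k $ i) 0"
  have "f ?y \<le> f (x k) + grad f (x k) \<bullet> d + Lf / 2 * (norm d)\<^sup>2"
    unfolding d_def using Lipschitz_grad_upper_bound[OF C_convex x_in x_in f_diff f_lip] .
  moreover have "(\<Sum>i\<in>UNIV. psi (lam k) (g ?y $ i) (z k $ i)) \<le>
      (\<Sum>i\<in>UNIV. psi (lam k) (g (x k) $ i) (z k $ i) + ?w i * (grad (\<lambda>y. g y $ i) (x k) \<bullet> d)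
        + (lam k * (B $ i)\<^sup>2 + Lg $ i * ?w i) * ((norm d)\<^sup>2 / 2))"
  proof (rule sum_mono)
    fix i
    have "psi (lam k) (g ?y $ i) (z k $ i) \<le> psi (lam k) (g (x k) $ i) (z k $ i)
        + ?w i * (g ?y $ i - g (x k) $ i) + lam k / 2 * (g ?y $ i - g (x k) $ i)\<^sup>2"
      by (rule psi_quadratic_upper_bound[OF lam_pos])
    moreover have "?w i * (g ?y $ i - g (x k) $ i)
        \<le> ?w i * (grad (\<lambda>y. g y $ i) (x k) \<bullet> d + Lg $ i / 2 * (norm d)\<^sup>2)"
    proof (intro mult_left_mono)
      have "g ?y $ i \<le> g (x k) $ i + grad (\<lambda>y. g y $ i) (x k) \<bullet> d + Lg $ i / 2 * (norm d)\<^sup>2"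
        unfolding d_def using Lipschitz_grad_upper_bound[OF C_convex x_in x_in g_diff g_lip] .
      then show "g ?y $ i - g (x k) $ i \<le> grad (\<lambda>y. g y $ i) (x k) \<bullet> d + Lg $ i / 2 * (norm d)\<^sup>2"
        by simp
    qed simp
    moreover have "lam k / 2 * (g ?y $ i - g (x k) $ i)\<^sup>2 \<le> lam k / 2 * (B $ i * norm d)\<^sup>2"
    proof (rule mult_left_mono)
      have "\<bar>g ?y $ i - g (x k) $ i\<bar>\<^sup>2 \<le> (B $ i * norm d)\<^sup>2"
        using g_bound[OF x_in x_in, of "Suc k" i k] by (intro power_mono) (auto simp: d_def)
      then show "(g ?y $ i - g (x k) $ i)\<^sup>2 \<le> (B $ i * norm d)\<^sup>2" by simp
    qed (use lam_pos[of k] in simp)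
    ultimately show "psi (lam k) (g ?y $ i) (z k $ i) \<le> psi (lam k) (g (x k) $ i) (z k $ i)
        + ?w i * (grad (\<lambda>y. g y $ i) (x k) \<bullet> d) + (lam k * (B $ i)\<^sup>2 + Lg $ i * ?w i) * ((norm d)\<^sup>2 / 2)"
      by (simp add: algebra_simps power_mult_distrib)
  qed
  ultimately have "F_AL f g (lam k) ?y (z k)
      \<le> F_AL f g (lam k) (x k) (z k) + u k \<bullet> d + L k * ((norm d)\<^sup>2 / 2)"
    unfolding F_AL_def Psi_eq_sum_psi u_def al_grad_inner L_def L_Psi_def sum.distrib
      sum_distrib_right[symmetric] by (simp add: algebra_simps)
  also have "u k \<bullet> d = - \<alpha> k * G k"
    by (simp add: d_def x_Suc G_def inner_diff_right algebra_simps)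
  also have "norm d = \<bar>\<alpha> k\<bar> * norm (v k - x k)" by (simp add: d_def x_Suc)
  finally show ?thesis by (simp add: decrease_def power_mult_distrib algebra_simps)
qed

lemma decrease_bounds:
  shows decrease_nonneg: "0 \<le> decrease k"
    and "\<lbrakk>G k > 0; A > 0; (norm (v k - x k))\<^sup>2 \<le> A * G k powr (1 - \<mu>)\<rbrakk> \<Longrightarrow>
      min (G k / 2) (G k powr (1 + \<mu>) / (2 * L k * A)) \<le> decrease k"
proof -
  have "norm (v k - x k) = 0 \<Longrightarrow> G k = 0" by (simp add: G_def)
  moreover have "\<alpha> k = (if G k = 0 \<and> norm (v k - x k) = 0 then 0
      else min 1 (G k / (L k * (norm (v k - x k))\<^sup>2)))"
    using \<alpha>_short[of k] by (simp add: G_def u_def L_def Let_def)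
  ultimately show "0 \<le> decrease k"
    and "\<lbrakk>G k > 0; A > 0; (norm (v k - x k))\<^sup>2 \<le> A * G k powr (1 - \<mu>)\<rbrakk> \<Longrightarrow>
      min (G k / 2) (G k powr (1 + \<mu>) / (2 * L k * A)) \<le> decrease k"
    unfolding decrease_def using short_step_decrease[OF G_nonneg L_pos norm_ge_zero] by blast+
qed

text \<open>Exactness of the linear penalty prevents \<open>f\<close> from falling below
  \<open>f xs\<close> by more than \<open>\<zeta>\<close> times the violation. Half of the quadratic
  penalty absorbs this loss, and the other half controls the squared violation.\<close>

lemma violation_bound:
  "\<exists>K>0. \<forall>y l w t i. y \<in> C \<longrightarrow> l > 0 \<longrightarrow> (\<forall>i. 0 \<le> w $ i \<and> w $ i \<le> Z) \<longrightarrow> t \<ge> 0 \<longrightarrow>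
    F_AL f g l y w - f xs \<le> t \<longrightarrow> (max (g y $ i) 0)\<^sup>2 \<le> K * (1 / l\<^sup>2 + t / l)"
proof -
  \<comment> \<open>Over all constraints, this collects \<open>\<zeta>\<^sup>2\<close> from
    completing the square and \<open>Z\<^sup>2 / 2\<close> from the lower bound on
    \<open>psi\<close>.\<close>
  define q where "q = real CARD('m) * (\<zeta>\<^sup>2 + Z\<^sup>2 / 2)"
  have "q \<ge> 0" by (simp add: q_def)
  have "(max (g y $ i) 0)\<^sup>2 \<le> (4 * q + 4) * (1 / l\<^sup>2 + t / l)"
    if y: "y \<in> C" and l: "l > 0" and w: "\<forall>i. 0 \<le> w $ i \<and> w $ i \<le> Z" and t: "t \<ge> 0"
      and F: "F_AL f g l y w - f xs \<le> t" for y l w t i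
  proof -
    define s where "s i = max (g y $ i) 0" for i
    have "(\<Sum>i\<in>UNIV. l / 4 * (s i)\<^sup>2 - (\<zeta>\<^sup>2 + Z\<^sup>2 / 2) / l)
        \<le> (\<Sum>i\<in>UNIV. psi l (g y $ i) (w $ i) - \<zeta> * s i)"
    proof (rule sum_mono)
      fix i
      have "(w $ i)\<^sup>2 / (2 * l) \<le> Z\<^sup>2 / (2 * l)"
        using w l by (intro divide_right_mono power_mono) auto
      moreover have "l / 2 * (s i)\<^sup>2 - (w $ i)\<^sup>2 / (2 * l) \<le> psi l (g y $ i) (w $ i)"
        unfolding s_def using psi_lower_bound[OF l] w by blast
      moreover have "\<zeta> * s i \<le> l / 4 * (s i)\<^sup>2 + \<zeta>\<^sup>2 / l"
      proof -
        have "0 \<le> (l / 2 * s i - \<zeta>)\<^sup>2 / l" using l by simp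
        also have "\<dots> = l / 4 * (s i)\<^sup>2 - \<zeta> * s i + \<zeta>\<^sup>2 / l"
          using l by (simp add: power2_eq_square field_simps)
        finally show ?thesis by simp
      qed
      ultimately show "l / 4 * (s i)\<^sup>2 - (\<zeta>\<^sup>2 + Z\<^sup>2 / 2) / l \<le> psi l (g y $ i) (w $ i) - \<zeta> * s i"
        by (simp add: add_divide_distrib)
    qed
    also have "\<dots> = (\<Sum>i\<in>UNIV. psi l (g y $ i) (w $ i)) - \<zeta> * (\<Sum>i\<in>UNIV. s i)"
      by (simp add: sum_subtractf sum_distrib_left)
    also have "\<dots> \<le> t"
      using F exact_penalty[OF y] by (simp add: F_AL_def Psi_eq_sum_psi s_def)
    finally have "l / 4 * (\<Sum>i\<in>UNIV. (s i)\<^sup>2) \<le> t + q / l"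
      by (simp add: sum_subtractf sum_distrib_left q_def)
    moreover have "l / 4 * (s i)\<^sup>2 \<le> l / 4 * (\<Sum>i\<in>UNIV. (s i)\<^sup>2)"
      using l by (intro mult_left_mono member_le_sum) auto
    ultimately have "l / 4 * (s i)\<^sup>2 \<le> t + q / l" by linarith
    then have "(4 / l) * (l / 4 * (s i)\<^sup>2) \<le> (4 / l) * (t + q / l)"
      using l by (intro mult_left_mono) auto
    then have "(s i)\<^sup>2 \<le> 4 * (t / l) + 4 * q * (1 / l\<^sup>2)"
      using l by (simp add: power2_eq_square distrib_left)
    also have "\<dots> \<le> (4 * q + 4) * (t / l) + (4 * q + 4) * (1 / l\<^sup>2)"
      using l t \<open>q \<ge> 0\<close> by (intro add_mono mult_right_mono) auto
    finally show ?thesis by (simp add: s_def algebra_simps)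
  qed
  then show ?thesis using \<open>q \<ge> 0\<close> by (intro exI[of _ "4 * q + 4"]) auto
qed

text \<open>The iteration is split in two: first the point moves under the old parameters, then the
  parameters change at the new point. The second part is estimated by \<open>psi_update_le\<close>,
  where \<open>R\<close> controls the growth of \<open>lam\<close>.\<close>

lemma excess_recursion:
  assumes "R > 0"
  shows "\<exists>K>0. \<forall>k. lam (Suc k) \<le> R * lam k \<longrightarrow> excess (Suc k) \<le> excess k - decrease k
    + K * ((lam (Suc k) - lam k) + sig k) * (1 / (lam k)\<^sup>2 + max (excess k) 0 / lam k)"
proof -
  obtain Z where Z: "Z > 0" "\<And>k i. z k $ i \<le> Z" using z_bounded by blast
  obtain K where K: "K > 0" and viol: "\<And>y l w t i. \<lbrakk>y \<in> C; l > 0; \<And>i. 0 \<le> w $ i \<and> w $ i \<le> Z; t \<ge> 0;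
    F_AL f g l y w - f xs \<le> t\<rbrakk> \<Longrightarrow> (max (g y $ i) 0)\<^sup>2 \<le> K * (1 / l\<^sup>2 + t / l)"
    using violation_bound[of Z] by blast
  define K' where "K' = real CARD('m) * (2 * R * (2 * Z\<^sup>2 + 2 * K))"
  have "excess (Suc k) \<le> excess k - decrease k
    + K' * ((lam (Suc k) - lam k) + sig k) * (1 / (lam k)\<^sup>2 + max (excess k) 0 / lam k)"
    if R: "lam (Suc k) \<le> R * lam k" for k
  proof -
    let ?y = "x (Suc k)" and ?l = "lam k"
    define t where "t = max (excess k) 0"
    define r where "r = 1 / ?l\<^sup>2 + t / ?l"
    define \<sigma> where "\<sigma> = (lam (Suc k) - lam k) + sig k"
    have l: "?l > 0" by (rule lam_pos)
    have "F_AL f g ?l ?y (z k) - f xs \<le> excess k - decrease k"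
      using sufficient_decrease[of k] by (simp add: excess_def)
    \<comment> \<open>The step does not increase the augmented Lagrangian, so the new point obeys
      the violation bound with the old excess and the old penalty parameter.\<close>
    then have "F_AL f g ?l ?y (z k) - f xs \<le> t"
      using decrease_nonneg[of k] by (simp add: t_def)
    then have s2: "(max (g ?y $ i) 0)\<^sup>2 \<le> K * r" for i
      unfolding r_def using z_nonneg Z by (intro viol x_in l) (auto simp: t_def)
    have \<sigma>: "\<sigma> \<ge> 0" using lam_less[of k] sig_pos[of k] by (simp add: \<sigma>_def)
    have "psi (lam (Suc k)) (g ?y $ i) (z (Suc k) $ i) - psi ?l (g ?y $ i) (z k $ i)
        \<le> 2 * R * (2 * Z\<^sup>2 + 2 * K) * \<sigma> * r" for i
    proof -
      \<comment> \<open>A multiplier step is at least \<open>- Z / ?l\<close> and at most the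
        positive part of the constraint value, both before and after the update.\<close>
      define P where "P = Z / ?l + max (g ?y $ i) 0"
      have bound: "\<bar>max (- (z j $ i) / l') (g ?y $ i)\<bar> \<le> P" if "l' \<ge> ?l" for j l'
      proof -
        have "z j $ i / l' \<le> Z / ?l"
          using Z(2)[of j i] z_nonneg[of j i] that l by (intro frac_le) auto
        moreover have "0 \<le> z j $ i / l'" using z_nonneg[of j i] that l by simp
        ultimately show ?thesis by (auto simp: P_def)
      qed
      have zS: "z (Suc k) $ i = z k $ i + sig k * max (- (z k $ i) / ?l) (g ?y $ i)"
        by (simp add: z_Suc)
      have "psi (lam (Suc k)) (g ?y $ i) (z (Suc k) $ i) - psi ?l (g ?y $ i) (z k $ i)
          \<le> 2 * R * \<sigma> * P\<^sup>2"
        unfolding zS \<sigma>_def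
        using lam_less[of k] sig_pos[of k] bound[of "lam (Suc k)" "Suc k", unfolded zS]
        by (intro psi_update_le l R sig_le z_nonneg bound) auto
      also have "\<dots> \<le> 2 * R * \<sigma> * ((2 * Z\<^sup>2 + 2 * K) * r)"
      proof (rule mult_left_mono)
        have "0 \<le> (Z / ?l - max (g ?y $ i) 0)\<^sup>2" by simp
        then have "P\<^sup>2 \<le> 2 * (Z / ?l)\<^sup>2 + 2 * (max (g ?y $ i) 0)\<^sup>2"
          unfolding P_def by (simp add: power2_sum power2_diff)
        also have "\<dots> \<le> 2 * (Z\<^sup>2 * r) + 2 * (K * r)"
        proof -
          have "(Z / ?l)\<^sup>2 = Z\<^sup>2 * (1 / ?l\<^sup>2)" by (simp add: power_divide)
          also have "\<dots> \<le> Z\<^sup>2 * r" unfolding r_def using l by (intro mult_left_mono) (auto simp: t_def)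
          finally show ?thesis using s2[of i] by linarith
        qed
        finally show "P\<^sup>2 \<le> (2 * Z\<^sup>2 + 2 * K) * r" by (simp add: algebra_simps)
      qed (use assms \<sigma> in auto)
      finally show ?thesis by (simp add: mult_ac)
    qed
    then have "(\<Sum>i\<in>UNIV. psi (lam (Suc k)) (g ?y $ i) (z (Suc k) $ i) - psi ?l (g ?y $ i) (z k $ i))
        \<le> of_nat (card (UNIV :: 'm set)) * (2 * R * (2 * Z\<^sup>2 + 2 * K) * \<sigma> * r)"
      by (intro sum_bounded_above) auto
    then have "F_AL f g (lam (Suc k)) ?y (z (Suc k)) \<le> F_AL f g ?l ?y (z k) + K' * \<sigma> * r"
      by (simp add: F_AL_def Psi_eq_sum_psi sum_subtractf K'_def mult_ac)
    then show ?thesis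
      using sufficient_decrease[of k] by (simp add: excess_def \<sigma>_def r_def t_def)
  qed
  moreover have "K' > 0" unfolding K'_def using assms K by (simp add: add_nonneg_pos)
  ultimately show ?thesis by blast
qed

text \<open>The update cost is of order \<open>\<tau> - 1\<close> times
  \<open>1 / (lam k)\<^sup>2 + T k / lam k\<close>, which gives the orders
  \<open>-1 - \<tau>\<close> and \<open>T k / k\<close>. The distance estimate is kept as a
  hypothesis in \<open>\<mu>\<close>, so that both passes can use the same recursion.\<close>

lemma excess_pos_part_recursion:
  assumes \<mu>: "0 \<le> \<mu>" and A: "A > 0" and r: "r > 0"
    and lam_lower: "\<forall>\<^sub>F k in sequentially. r * real k powr \<tau> \<le> lam k"
    and lam_upper: "\<forall>\<^sub>F k in sequentially. lam k \<le> R * real k powr \<tau>"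
    and lam_diff: "\<forall>\<^sub>F k in sequentially. lam (Suc k) - lam k \<le> R * real k powr (\<tau> - 1)"
    and sig_upper: "\<forall>\<^sub>F k in sequentially. sig k \<le> R * real k powr (\<tau> - 1)"
    and dist: "\<forall>\<^sub>F k in sequentially. G k > 0 \<longrightarrow> (norm (v k - x k))\<^sup>2 \<le> A * G k powr (1 - \<mu>)"
  defines "T k \<equiv> max (excess k) 0"
  shows "\<exists>c>0. \<exists>C>0. \<forall>\<^sub>F k in sequentially. T (Suc k) \<le> T k
      - min (T k / 2) (c * T k powr (1 + \<mu>) * real k powr (- \<tau>))
      + C * real k powr (- 1 - \<tau>) + C * T k / real k"
proof -
  \<comment> \<open>Positivity of \<open>R\<close> is read off from one index at which the positive
    \<open>sig\<close> obeys its upper bound.\<close>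
  obtain k0 where "k0 > 0" "sig k0 \<le> R * real k0 powr (\<tau> - 1)"
    using eventually_happens'[OF sequentially_bot eventually_conj[OF sig_upper eventually_gt_at_top[of 0]]]
    by blast
  then have "0 < R * real k0 powr (\<tau> - 1)" using sig_pos[of k0] by linarith
  then have R: "R > 0" using \<open>k0 > 0\<close> by (simp add: zero_less_mult_iff)
  obtain M where M: "M > 0" "\<And>k. L k \<le> M * lam k" using L_le by blast
  \<comment> \<open>Eventually an increment of \<open>lam\<close> is at most
    \<open>R / r * lam k\<close>, hence this bound on the ratio of consecutive parameters.\<close>
  define R' where "R' = 1 + R / r"
  have "R' > 0" unfolding R'_def using R r by (simp add: add_pos_pos)
  obtain K where K: "K > 0" and excess_Suc: "\<And>k. lam (Suc k) \<le> R' * lam k \<Longrightarrow>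
      excess (Suc k) \<le> excess k - decrease k
    + K * ((lam (Suc k) - lam k) + sig k) * (1 / (lam k)\<^sup>2 + max (excess k) 0 / lam k)"
    using excess_recursion[OF \<open>R' > 0\<close>] by blast
  define c where "c = 1 / (2 * M * R * A)"
  define D where "D = K * (2 * R) * (1 / r\<^sup>2 + 1 / r)"
  have "c > 0" "D > 0" using M R A K r by (simp_all add: c_def D_def add_pos_pos)
  have "\<forall>\<^sub>F k in sequentially. T (Suc k) \<le> T k
      - min (T k / 2) (c * T k powr (1 + \<mu>) * real k powr (- \<tau>))
      + D * real k powr (- 1 - \<tau>) + D * T k / real k"
    using eventually_gt_at_top[of 0] lam_lower lam_upper lam_diff sig_upper dist
  proof eventually_elim
    case (elim k)
    define \<kappa> where "\<kappa> = real k powr \<tau>"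
    have k: "\<kappa> > 0" "real k \<ge> 1" using elim(1) by (simp_all add: \<kappa>_def)
    have \<kappa>1: "real k powr (\<tau> - 1) = \<kappa> / real k" using elim(1) by (simp add: \<kappa>_def powr_diff)
    have l: "r * \<kappa> \<le> lam k" "lam k \<le> R * \<kappa>" "lam (Suc k) - lam k \<le> R * (\<kappa> / real k)"
      "sig k \<le> R * (\<kappa> / real k)" using elim(2-5) unfolding \<kappa>1 by (simp_all add: \<kappa>_def)
    have T0: "T k \<ge> 0" by (simp add: T_def)
    have dec: "min (T k / 2) (c * T k powr (1 + \<mu>) / \<kappa>) \<le> decrease k"
    proof (cases "T k > 0")
      case True
      then have TG: "T k \<le> G k" using excess_le_G[of k] G_nonneg[of k] by (simp add: T_def)
      then have "G k > 0" using True by simp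
      have "T k powr (1 + \<mu>) \<le> G k powr (1 + \<mu>)" using TG T0 \<mu> by (intro powr_mono2) auto
      moreover have "L k \<le> M * (R * \<kappa>)"
        using M(2)[of k] mult_left_mono[OF l(2), of M] M(1) by linarith
      then have "2 * L k * A \<le> 2 * (M * (R * \<kappa>)) * A" using A by simp
      ultimately have "T k powr (1 + \<mu>) / (2 * (M * (R * \<kappa>)) * A) \<le> G k powr (1 + \<mu>) / (2 * L k * A)"
        using L_pos[of k] A by (intro frac_le) auto
      moreover have "c * T k powr (1 + \<mu>) / \<kappa> = T k powr (1 + \<mu>) / (2 * (M * (R * \<kappa>)) * A)"
        by (simp add: c_def)
      moreover have "min (G k / 2) (G k powr (1 + \<mu>) / (2 * L k * A)) \<le> decrease k"
        using decrease_bounds(2)[OF \<open>G k > 0\<close> A] elim(6) \<open>G k > 0\<close> by blast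
      ultimately show ?thesis using TG by linarith
    next
      case False
      then show ?thesis using T0 decrease_nonneg[of k] by simp
    qed
    have "real k * (\<kappa> / real k) \<ge> 1 * (\<kappa> / real k)" using k by (intro mult_right_mono) auto
    then have "\<kappa> / real k \<le> \<kappa>" using elim(1) by simp
    then have "R * (\<kappa> / real k) \<le> R * \<kappa>" using R by (intro mult_left_mono) auto
    also have "\<dots> = R / r * (r * \<kappa>)" using r by simp
    also have "\<dots> \<le> R / r * lam k" using l(1) R r by (intro mult_left_mono) auto
    finally have "lam (Suc k) \<le> R' * lam k" using l(3) by (simp add: R'_def distrib_right)
    from excess_Suc[OF this]
    have "excess (Suc k) \<le> excess k - decrease k
        + K * ((lam (Suc k) - lam k) + sig k) * (1 / (lam k)\<^sup>2 + T k / lam k)"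
      by (simp add: T_def)
    also have "K * ((lam (Suc k) - lam k) + sig k) * (1 / (lam k)\<^sup>2 + T k / lam k)
        \<le> K * (2 * R * (\<kappa> / real k)) * (1 / (r * \<kappa>)\<^sup>2 + T k / (r * \<kappa>))"
    proof (intro mult_mono add_mono frac_le mult_left_mono power_mono)
      show "0 \<le> 1 / (lam k)\<^sup>2 + T k / lam k" using T0 lam_pos[of k] by simp
    qed (use l K R k r T0 lam_less[of k] sig_pos[of k] in auto)
    also have "\<dots> = K * (2 * R) / r\<^sup>2 * (1 / (\<kappa> * real k)) + K * (2 * R) / r * (T k / real k)"
      using k r by (simp add: field_simps power2_eq_square)
    also have "\<dots> \<le> D * (1 / (\<kappa> * real k)) + D * (T k / real k)"
      using K R r k T0 by (intro add_mono mult_right_mono) (auto simp: D_def field_simps)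
    also have "1 / (\<kappa> * real k) = real k powr (- 1 - \<tau>)"
      using elim(1) by (simp add: \<kappa>_def powr_diff powr_minus field_simps)
    finally have upper: "excess (Suc k) \<le> excess k - decrease k
        + (D * real k powr (- 1 - \<tau>) + D * (T k / real k))" by simp
    have d: "min (T k / 2) (c * T k powr (1 + \<mu>) * real k powr (- \<tau>)) \<le> decrease k"
      using dec by (simp add: \<kappa>_def powr_minus field_simps)
    have E: "0 \<le> D * real k powr (- 1 - \<tau>) + D * (T k / real k)"
      using \<open>D > 0\<close> T0 by simp
    have "excess k \<le> T k" by (simp add: T_def)
    \<comment> \<open>The subtracted minimum is at most \<open>T k\<close>, so the right-hand side
      stays nonnegative and the bound passes to the positive part.\<close>
    moreover have "min (T k / 2) (c * T k powr (1 + \<mu>) * real k powr (- \<tau>)) \<le> T k"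
      using T0 by (simp add: min_def)
    moreover have "T (Suc k) = max (excess (Suc k)) 0" by (simp add: T_def)
    ultimately have "T (Suc k) \<le> T k - min (T k / 2) (c * T k powr (1 + \<mu>) * real k powr (- \<tau>))
        + (D * real k powr (- 1 - \<tau>) + D * (T k / real k))"
      using upper d E by linarith
    then show ?case by simp
  qed
  then show ?thesis using \<open>c > 0\<close> \<open>D > 0\<close> by blast
qed

text \<open>A bounded excess and \<open>lam\<close> tending to infinity force the violation to zero.
  Where a constraint is below \<open>- \<epsilon>\<close>, the product with \<open>lam k\<close>
  outweighs the bounded multiplier, so the shifted multiplier vanishes. The shifted multipliers, not
  \<open>z k\<close>, are those appearing in the gradient.\<close>

lemma eventually_approx_compl:
  assumes "\<epsilon> > 0" and bdd: "\<forall>\<^sub>F k in sequentially. max (excess k) 0 \<le> M"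
  shows "\<forall>\<^sub>F k in sequentially.
    (x k, \<chi> i. max (lam k * g (x k) $ i + z k $ i) 0) \<in> approx_compl_set g \<epsilon>"
proof -
  obtain Z where Z: "Z > 0" "\<And>k i. z k $ i \<le> Z" using z_bounded by blast
  obtain K where K: "K > 0" and viol: "\<And>y l w t i. \<lbrakk>y \<in> C; l > 0; \<And>i. 0 \<le> w $ i \<and> w $ i \<le> Z; t \<ge> 0;
    F_AL f g l y w - f xs \<le> t\<rbrakk> \<Longrightarrow> (max (g y $ i) 0)\<^sup>2 \<le> K * (1 / l\<^sup>2 + t / l)"
    using violation_bound[of Z] by blast
  have inv: "(\<lambda>k. 1 / lam k) \<longlonglongrightarrow> 0"
    using tendsto_inverse_0_at_top[OF lam_top] by (simp add: inverse_eq_divide)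
  have "(\<lambda>k. K * ((1 / lam k)\<^sup>2 + M * (1 / lam k))) \<longlonglongrightarrow> K * (0\<^sup>2 + M * 0)"
    by (intro tendsto_intros inv)
  then have "\<forall>\<^sub>F k in sequentially. K * ((1 / lam k)\<^sup>2 + M * (1 / lam k)) < \<epsilon>\<^sup>2"
    using order_tendstoD(2)[of _ 0] \<open>\<epsilon> > 0\<close> by fastforce
  moreover have "\<forall>\<^sub>F k in sequentially. Z / \<epsilon> \<le> lam k"
    using lam_top by (simp add: filterlim_at_top)
  ultimately show ?thesis using bdd
  proof eventually_elim
    case (elim k)
    have l: "lam k > 0" by (rule lam_pos)
    have "g (x k) $ i \<le> \<epsilon>" for i
    proof -
      have "(max (g (x k) $ i) 0)\<^sup>2 \<le> K * (1 / (lam k)\<^sup>2 + max (excess k) 0 / lam k)"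
        using z_nonneg Z by (intro viol[of _ _ "z k"] x_in l) (auto simp: excess_def)
      also have "\<dots> \<le> K * (1 / (lam k)\<^sup>2 + M / lam k)"
        using elim(3) l K by (intro mult_left_mono add_left_mono divide_right_mono) auto
      also have "\<dots> \<le> \<epsilon>\<^sup>2" using elim(1) by (simp add: power_divide)
      finally have "max (g (x k) $ i) 0 \<le> \<epsilon>"
        by (rule power2_le_imp_le) (use \<open>\<epsilon> > 0\<close> in simp)
      then show ?thesis by simp
    qed
    moreover have "lam k * g (x k) $ i + z k $ i \<le> 0" if "g (x k) $ i < - \<epsilon>" for i
    proof -
      have "lam k * g (x k) $ i \<le> lam k * (- \<epsilon>)" using that l by (intro mult_left_mono) auto
      moreover have "Z \<le> lam k * \<epsilon>" using elim(2) \<open>\<epsilon> > 0\<close> by (simp add: pos_divide_le_eq)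
      ultimately show ?thesis using Z(2)[of k i] by simp
    qed
    ultimately show ?case by (simp add: approx_compl_set_def max_absorb2)
  qed
qed

lemma excess_rate:
  assumes unif: "uniformly_convex_set \<nu> q C" and \<tau>: "0 < \<tau>" "\<tau> < 1" and r: "r > 0"
    and lam_lower: "\<forall>\<^sub>F k in sequentially. r * real k powr \<tau> \<le> lam k"
    and lam_upper: "\<forall>\<^sub>F k in sequentially. lam k \<le> R * real k powr \<tau>"
    and lam_diff: "\<forall>\<^sub>F k in sequentially. lam (Suc k) - lam k \<le> R * real k powr (\<tau> - 1)"
    and sig_upper: "\<forall>\<^sub>F k in sequentially. sig k \<le> R * real k powr (\<tau> - 1)"
    and \<epsilon>: "\<epsilon> > 0" and \<delta>: "\<delta> > 0"
    and grad_lower: "\<And>y w. \<lbrakk>y \<in> C; (y, w) \<in> approx_compl_set g \<epsilon>\<rbrakk> \<Longrightarrow>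
      \<delta> \<le> norm (grad f y + (\<Sum>i\<in>UNIV. w $ i *\<^sub>R grad (\<lambda>y. g y $ i) y))"
  defines "\<mu> \<equiv> 1 - 2 / q"
  defines "\<rho> \<equiv> min (1 / (1 + \<mu>)) ((2 - 2 * \<tau>) / (1 + \<mu>))"
  shows "\<exists>M>0. \<forall>\<^sub>F k in sequentially. max (excess k) 0 \<le> M * real k powr (- \<rho>)"
proof -
  have \<nu>: "\<nu> > 0" and q: "q \<ge> 2" using unif by (auto simp: uniformly_convex_set_def)
  have \<mu>: "0 \<le> \<mu>" "\<mu> < 1" using q by (simp_all add: \<mu>_def)
  obtain D where D: "D > 0" "\<And>y y'. \<lbrakk>y \<in> C; y' \<in> C\<rbrakk> \<Longrightarrow> norm (y - y') \<le> D"
  proof -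
    obtain D where D: "\<forall>y\<in>C. norm y \<le> D" using C_bounded by (auto simp: bounded_iff)
    have "norm (y - y') \<le> 2 * \<bar>D\<bar> + 1" if "y \<in> C" "y' \<in> C" for y y'
    proof -
      have "norm y \<le> D" "norm y' \<le> D" using D that by blast+
      then show ?thesis using norm_triangle_ineq4[of y y'] by linarith
    qed
    then show thesis by (intro that[of "2 * \<bar>D\<bar> + 1"]) auto
  qed
  note rates = lam_lower lam_upper lam_diff sig_upper

  \<comment> \<open>First pass with \<open>\<mu> = 1\<close> and \<open>\<rho> = 0\<close>: the
    distance estimate is the bounded diameter, because \<open>G k powr 0 = 1\<close>. Only
    boundedness of the excess is extracted.\<close>
  have "\<exists>M>0. \<forall>\<^sub>F k in sequentially. max (excess k) 0 \<le> M * real k powr (- 0)"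
  proof -
    have "(norm (v k - x k))\<^sup>2 \<le> D\<^sup>2 * G k powr (1 - 1)" if "G k > 0" for k
      using that D(2)[OF v_in x_in, of k k] by (simp add: power_mono)
    then have "\<forall>\<^sub>F k in sequentially. G k > 0 \<longrightarrow> (norm (v k - x k))\<^sup>2 \<le> D\<^sup>2 * G k powr (1 - 1)"
      by simp
    then obtain c A where "c > 0" "A > 0" "\<forall>\<^sub>F k in sequentially. max (excess (Suc k)) 0 \<le> max (excess k) 0
      - min (max (excess k) 0 / 2) (c * max (excess k) 0 powr (1 + 1) * real k powr (- \<tau>))
      + A * real k powr (- 1 - \<tau>) + A * max (excess k) 0 / real k"
      using excess_pos_part_recursion[OF zero_le_one _ r rates, of "D\<^sup>2"] D(1) zero_less_power
      by blast
    then show ?thesis using \<tau> by (intro recursion_rate[where \<mu> = 1 and \<tau> = \<tau> and c = c and C = A]) auto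
  qed
  then obtain M where "\<forall>\<^sub>F k in sequentially. max (excess k) 0 \<le> M * real k powr (- 0)" by blast
  then have "\<forall>\<^sub>F k in sequentially. max (excess k) 0 \<le> M"
    using eventually_gt_at_top[of 0] by eventually_elim simp
  then have near: "\<forall>\<^sub>F k in sequentially.
      (x k, \<chi> i. max (lam k * g (x k) $ i + z k $ i) 0) \<in> approx_compl_set g \<epsilon>"
    by (rule eventually_approx_compl[OF \<epsilon>])

  define \<kappa> where "\<kappa> = \<nu> / 2 * \<delta>"
  have "\<kappa> > 0" using \<nu> \<delta> by (simp add: \<kappa>_def)
  \<comment> \<open>Second pass: the gap bound \<open>\<kappa> * n powr q \<le> G k\<close> is
    raised to the power \<open>2 / q\<close>, which equals \<open>1 - \<mu>\<close>.\<close>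
  have "\<forall>\<^sub>F k in sequentially. G k > 0 \<longrightarrow>
      (norm (v k - x k))\<^sup>2 \<le> \<kappa> powr (- (2 / q)) * G k powr (1 - \<mu>)"
    using near
  proof eventually_elim
    case (elim k)
    define n where "n = norm (x k - v k)"
    have "\<delta> \<le> norm (u k)"
      using grad_lower[OF x_in elim] by (simp add: u_def al_grad_def)
    then have "\<kappa> * n powr q \<le> \<nu> / 2 * norm (u k) * n powr q"
      unfolding \<kappa>_def using \<nu> by (intro mult_right_mono mult_left_mono) auto
    also have "\<dots> \<le> G k"
      unfolding G_def n_def using v_min
      by (intro uniformly_convex_set_gap[OF unif x_in v_in]) (simp add: u_def)
    finally have "n powr q \<le> G k / \<kappa>" using \<open>\<kappa> > 0\<close> by (simp add: field_simps)
    then have "(n powr q) powr (2 / q) \<le> (G k / \<kappa>) powr (2 / q)"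
      using q by (intro powr_mono2) auto
    moreover have "(n powr q) powr (2 / q) = n\<^sup>2"
      using q by (simp add: powr_powr n_def)
    ultimately have "n\<^sup>2 \<le> \<kappa> powr (- (2 / q)) * G k powr (1 - \<mu>)"
      using \<open>\<kappa> > 0\<close> G_nonneg[of k] by (simp add: \<mu>_def powr_divide powr_minus field_simps)
    then show ?case by (simp add: n_def norm_minus_commute)
  qed
  then obtain c A where cA: "c > 0" "A > 0"
      "\<forall>\<^sub>F k in sequentially. max (excess (Suc k)) 0 \<le> max (excess k) 0
      - min (max (excess k) 0 / 2) (c * max (excess k) 0 powr (1 + \<mu>) * real k powr (- \<tau>))
      + A * real k powr (- 1 - \<tau>) + A * max (excess k) 0 / real k"
    using excess_pos_part_recursion[OF \<mu>(1) _ r rates, of "\<kappa> powr (- (2 / q))"] \<open>\<kappa> > 0\<close>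
    by (metis (no_types, lifting) powr_gt_zero less_irrefl)
  have \<rho>_le: "\<rho> \<le> 1 / (1 + \<mu>)" "\<rho> \<le> (2 - 2 * \<tau>) / (1 + \<mu>)" by (simp_all add: \<rho>_def)
  have "0 \<le> \<rho>" using \<mu> \<tau> by (simp add: \<rho>_def)
  moreover have "\<rho> * (1 + \<mu>) \<le> 1" using \<rho>_le(1) \<mu> by (simp add: field_simps)
  moreover have "\<rho> \<le> 1" using calculation \<mu> mult_left_mono[of 1 "1 + \<mu>" \<rho>] by simp
  \<comment> \<open>This is where the second exponent is needed: \<open>\<mu> < 1\<close> gives
    \<open>2 * \<rho> * \<mu> < \<rho> * (1 + \<mu>) \<le> 2 - 2 * \<tau>\<close> for positive
    \<open>\<rho>\<close>.\<close>
  moreover have "\<rho> * \<mu> + \<tau> < 1"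
  proof -
    have "\<rho> * (1 + \<mu>) \<le> 2 - 2 * \<tau>" using \<rho>_le(2) \<mu> by (simp add: field_simps)
    moreover have "\<rho> * \<mu> < 1 - \<tau>"
    proof (cases "\<rho> = 0")
      case False
      then have "\<rho> > 0" using \<open>0 \<le> \<rho>\<close> by simp
      then have "\<rho> * (2 * \<mu>) < \<rho> * (1 + \<mu>)" using \<mu> by (intro mult_strict_left_mono) auto
      then show ?thesis using calculation by simp
    qed (use \<tau> in simp)
    ultimately show ?thesis by simp
  qed
  ultimately show ?thesis
    using \<mu> \<tau> cA by (intro recursion_rate[where \<mu> = \<mu> and \<tau> = \<tau> and c = c and C = A]) auto
qed

end

section \<open>Indicator functions and exact penalties\<close>

lemma edom_Ind: "edom (Ind C) = C"
  by (auto simp: edom_def Ind_def)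

text \<open>A point of \<open>C\<close> supplies a finite value, which forces minimizers into
  \<open>C\<close>. For empty \<open>C\<close> every point would minimize the constant
  infinity.\<close>

lemma lin_argmin_Ind:
  assumes "C \<noteq> {}"
  shows "lin_argmin (Ind C) u = {v \<in> C. \<forall>y\<in>C. v \<bullet> u \<le> y \<bullet> u}"
proof -
  obtain c where "c \<in> C" using assms by blast
  then show ?thesis
    unfolding lin_argmin_def Ind_def
    by (auto split: if_splits)
qed

text \<open>All minimizers share the same linear value, so the one picked by \<open>SOME\<close> can
  be exchanged for \<open>v\<close>.\<close>

lemma gap_Ind:
  assumes "C \<noteq> {}" "y \<in> C" "v \<in> lin_argmin (Ind C) (grad_F f g l y w)"
  shows "gap f g (Ind C) l y w = ereal (grad_F f g l y w \<bullet> (y - v))"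
proof -
  let ?u = "grad_F f g l y w"
  define v' where "v' = (SOME v. v \<in> lin_argmin (Ind C) ?u)"
  have "v' \<in> lin_argmin (Ind C) ?u" unfolding v'_def using assms(3) by (rule someI)
  then have "v' \<in> C" "v' \<bullet> ?u = v \<bullet> ?u"
    using assms(3) unfolding lin_argmin_Ind[OF assms(1)] by (auto intro: antisym)
  then show ?thesis
    using assms(2) unfolding gap_def Let_def v'_def[symmetric]
    by (simp add: Ind_def inner_commute[of ?u] inner_diff_left)
qed

text \<open>The subgradient \<open>s\<close> is normal to \<open>C\<close> at \<open>xs\<close>, so
  stationarity and convexity make \<open>xs\<close> a minimizer over \<open>C\<close> of the
  Lagrangian with multiplier \<open>zs\<close>. Bounding each constraint by the total violation
  turns the multiplier term into a penalty with constant the sum of the multipliers.\<close>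

lemma kkt_exact_penalty:
  assumes f: "convex_on UNIV f" "\<And>y. f differentiable (at y)"
    and g: "\<And>i. convex_on UNIV (\<lambda>y. g y $ i)" "\<And>i y. (\<lambda>y. g y $ i) differentiable (at y)"
    and kkt: "kkt_point f g (Ind C) xs zs" and C: "C \<noteq> {}"
  shows "xs \<in> C" "\<And>i. g xs $ i \<le> 0" "0 \<le> (\<Sum>i\<in>UNIV. zs $ i)"
    and "\<And>y. y \<in> C \<Longrightarrow> f xs \<le> f y + (\<Sum>i\<in>UNIV. zs $ i) * (\<Sum>i\<in>UNIV. max (g y $ i) 0)"
proof -
  obtain s where s: "\<And>y. Ind C xs + ereal (s \<bullet> (y - xs)) \<le> Ind C y"
    and stationary: "grad f xs + s + (\<Sum>i\<in>UNIV. zs $ i *\<^sub>R grad (\<lambda>y. g y $ i) xs) = 0"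
    using kkt by (auto simp: kkt_point_def subdifferential_def)
  have zs: "\<And>i. 0 \<le> zs $ i" and feas: "\<And>i. g xs $ i \<le> 0" and "zs \<bullet> g xs = 0"
    using kkt by (auto simp: kkt_point_def)
  then have compl: "(\<Sum>i\<in>UNIV. zs $ i * g xs $ i) = 0" by (simp add: inner_vec_def)
  obtain c where c: "c \<in> C" using C by blast
  show xs: "xs \<in> C"
    using s[of c] c by (auto simp: Ind_def split: if_splits)
  show "g xs $ i \<le> 0" for i by (rule feas)
  show sum_nonneg': "0 \<le> (\<Sum>i\<in>UNIV. zs $ i)" using zs by (simp add: sum_nonneg)
  fix y assume y: "y \<in> C"
  let ?d = "y - xs"
  have "s \<bullet> ?d \<le> 0" using s[of y] xs y by (simp add: Ind_def)
  moreover have "(grad f xs + s + (\<Sum>i\<in>UNIV. zs $ i *\<^sub>R grad (\<lambda>y. g y $ i) xs)) \<bullet> ?d = 0"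
    using stationary by simp
  then have "grad f xs \<bullet> ?d + s \<bullet> ?d + (\<Sum>i\<in>UNIV. zs $ i * (grad (\<lambda>y. g y $ i) xs \<bullet> ?d)) = 0"
    by (simp add: inner_add_left inner_sum_left)
  moreover have "f xs + grad f xs \<bullet> ?d \<le> f y"
    by (rule convex_on_imp_above_grad[OF f])
  moreover have "(\<Sum>i\<in>UNIV. zs $ i * (grad (\<lambda>y. g y $ i) xs \<bullet> ?d))
      \<le> (\<Sum>i\<in>UNIV. zs $ i * (g y $ i - g xs $ i))"
    using convex_on_imp_above_grad[OF g(1,2), of xs _ y] zs
    by (intro sum_mono mult_left_mono) (auto simp: algebra_simps)
  moreover have "(\<Sum>i\<in>UNIV. zs $ i * (g y $ i - g xs $ i)) = (\<Sum>i\<in>UNIV. zs $ i * g y $ i)"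
    using compl by (simp add: right_diff_distrib sum_subtractf)
  moreover have "(\<Sum>i\<in>UNIV. zs $ i * g y $ i) \<le> (\<Sum>i\<in>UNIV. zs $ i * (\<Sum>j\<in>UNIV. max (g y $ j) 0))"
  proof (intro sum_mono mult_left_mono zs)
    fix i
    have "g y $ i \<le> max (g y $ i) 0" by simp
    also have "\<dots> \<le> (\<Sum>j\<in>UNIV. max (g y $ j) 0)" by (rule member_le_sum) auto
    finally show "g y $ i \<le> (\<Sum>j\<in>UNIV. max (g y $ j) 0)" .
  qed
  ultimately show "f xs \<le> f y + (\<Sum>i\<in>UNIV. zs $ i) * (\<Sum>i\<in>UNIV. max (g y $ i) 0)"
    unfolding sum_distrib_right by linarith
qed

lemma optimal_value_Ind:
  assumes "xs \<in> C" "\<And>i. g xs $ i \<le> 0"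
    and "\<And>y. y \<in> C \<Longrightarrow> f xs \<le> f y + \<zeta> * (\<Sum>i\<in>UNIV. max (g y $ i) 0)"
  shows "optimal_value f g (Ind C) = ereal (f xs)"
  unfolding optimal_value_def
proof (rule antisym)
  show "(INF x\<in>{x. \<forall>i. g x $ i \<le> 0}. ereal (f x) + Ind C x) \<le> ereal (f xs)"
    using assms by (intro INF_lower2[of xs]) (auto simp: Ind_def)
  show "ereal (f xs) \<le> (INF x\<in>{x. \<forall>i. g x $ i \<le> 0}. ereal (f x) + Ind C x)"
  proof (rule INF_greatest)
    fix y assume "y \<in> {x. \<forall>i. g x $ i \<le> 0}"
    then have "(\<Sum>i\<in>UNIV. max (g y $ i) 0) = 0" by (simp add: max_absorb2)
    then show "ereal (f xs) \<le> ereal (f y) + Ind C y"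
      using assms(3)[of y] by (auto simp: Ind_def)
  qed
qed

theorem proposition5p3:
  fixes f :: "real^'n \<Rightarrow> real"
    and g :: "real^'n \<Rightarrow> real^'m"
    and h :: "real^'n \<Rightarrow> ereal"
    and C :: "(real^'n) set"
    and Lf \<nu> q \<tau> \<gamma> \<mu> :: real
    and Lg B :: "real^'m"
    and lam sig \<alpha> :: "nat \<Rightarrow> real"
    and x v :: "nat \<Rightarrow> real^'n"
    and z :: "nat \<Rightarrow> real^'m"
    and Lstar :: ereal
    and T :: "nat \<Rightarrow> ereal"
  assumes standing: "standing_assumptions f g h Lf Lg"
    and bounds: "constraint_bounds g h B"
    and h_ind: "h = Ind C"
    and C_compact: "compact C"
    and C_unif_convex: "uniformly_convex_set \<nu> q C"
    and grad_lower_bound: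
      "\<exists>\<epsilon>>0. (INF (y, w)\<in>approx_compl_set g \<epsilon> \<inter> (C \<times> UNIV).
          ereal (norm (grad f y + (\<Sum>i\<in>UNIV. w $ i *\<^sub>R grad (\<lambda>y. g y $ i) y)))) > 0"
    and algorithm: "algorithm_run f g h lam sig \<alpha> x v z"
    and tau: "0 < \<tau>" "\<tau> < 1"
    and lam_Theta: "lam \<in> \<Theta>(\<lambda>k. real k powr \<tau>)"
    and lam_diff: "(\<lambda>k. lam (Suc k) - lam k) \<in> O(\<lambda>k. real k powr (- (1 - \<tau>)))"
    and short: "\<And>k. \<alpha> k = short_step f g h Lf Lg B (lam k) (x k) (z k) (v k)"
    and gamma: "\<gamma> > 0"
    and sig_Theta: "sig \<in> \<Theta>(\<lambda>k. real k powr (- (1 + \<gamma>)))"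
    and Lstar: "Lstar = optimal_value f g h"
    and T: "\<And>k. T k = pos_part (aug_lagrangian f g h (lam k) (x k) (z k) - Lstar)"
    and mu: "\<mu> = 1 - 2 / q"
  shows "(\<forall>k. \<bar>T k\<bar> \<noteq> \<infinity>) \<and>
    (\<lambda>k. real_of_ereal (T k)) \<in>
      O(\<lambda>k. max (1 / real k powr (1 / (1 + \<mu>))) (1 / real k powr ((2 - 2 * \<tau>) / (1 + \<mu>))))"
proof -
  note std = standing[unfolded standing_assumptions_def h_ind edom_Ind]
  note bnd = bounds[unfolded constraint_bounds_def h_ind edom_Ind]
  note run = algorithm[unfolded algorithm_run_def h_ind edom_Ind]
  have C: "C \<noteq> {}" using run by auto
  have f: "convex_on UNIV f" "\<And>y. f differentiable (at y)"
    and g: "\<And>i. convex_on UNIV (\<lambda>y. g y $ i)" "\<And>i y. (\<lambda>y. g y $ i) differentiable (at y)"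
    using std by auto
  obtain xs zs where kkt: "kkt_point f g (Ind C) xs zs" using std by blast
  note pen = kkt_exact_penalty[OF f g kkt C]
  have lam: "\<And>k. 0 < lam k" using run by blast
  have x_Suc: "\<And>k. x (Suc k) = x k + \<alpha> k *\<^sub>R (v k - x k)"
    and \<alpha>: "\<And>k. \<alpha> k \<in> {0..1}" and x_0: "x 0 \<in> C" using run by auto
  have v: "v k \<in> lin_argmin (Ind C) (grad_F f g (lam k) (x k) (z k))" for k using run by blast
  have v_in: "v k \<in> C" for k using v[of k] by (simp add: lin_argmin_Ind[OF C])
  have "convex C" using C_unif_convex by (simp add: uniformly_convex_set_def)
  have x_in: "x k \<in> C" for k
    using \<open>convex C\<close> x_0 v_in \<alpha> x_Suc by (rule convex_iterates_in)
  have grad_F: "grad_F f g (lam k) y w = al_grad f g (lam k) y w" for k y w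
    by (rule grad_F_eq_al_grad[OF f(2) g(2) lam])

  interpret al_frank_wolfe f g C Lf Lg B lam sig \<alpha> x v z xs "\<Sum>i\<in>UNIV. zs $ i"
  proof
    show "v k \<bullet> al_grad f g (lam k) (x k) (z k) \<le> y \<bullet> al_grad f g (lam k) (x k) (z k)" if "y \<in> C" for k y
      using v[of k] that by (simp add: lin_argmin_Ind[OF C] grad_F)
    show "\<alpha> k = (let G = al_grad f g (lam k) (x k) (z k) \<bullet> (x k - v k)
       in if G = 0 \<and> norm (v k - x k) = 0 then 0
          else min 1 (G / ((L_Psi g B Lg (lam k) (x k) (z k) + Lf) * (norm (v k - x k))\<^sup>2)))" for k
      using short[of k] gap_Ind[OF C x_in v, of k] by (simp add: short_step_def h_ind grad_F)
    show "bounded C" using C_compact by (rule compact_imp_bounded)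
  qed (use std bnd run pen v_in \<open>convex C\<close> in auto)

  have opt: "optimal_value f g (Ind C) = ereal (f xs)"
    using pen(1,2) pen(4) by (rule optimal_value_Ind)
  have Tk: "T k = ereal (max (excess k) 0)" for k
    using x_in[of k]
    by (simp add: T Lstar h_ind opt aug_lagrangian_def excess_def Ind_def zero_ereal_def max_def)

  obtain \<epsilon> where \<epsilon>: "\<epsilon> > 0" and inf: "0 < (INF (y, w)\<in>approx_compl_set g \<epsilon> \<inter> (C \<times> UNIV).
      ereal (norm (grad f y + (\<Sum>i\<in>UNIV. w $ i *\<^sub>R grad (\<lambda>y. g y $ i) y))))"
    using grad_lower_bound by blast
  \<comment> \<open>The infimum is an \<open>ereal\<close> and may be infinite, so a real constant
    strictly between 0 and the infimum is chosen.\<close>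
  obtain \<delta> where \<delta>: "0 < ereal \<delta>" and \<delta>_less: "ereal \<delta> < (INF (y, w)\<in>approx_compl_set g \<epsilon> \<inter> (C \<times> UNIV).
      ereal (norm (grad f y + (\<Sum>i\<in>UNIV. w $ i *\<^sub>R grad (\<lambda>y. g y $ i) y))))"
    using ereal_dense2[OF inf] by blast
  have lower: "\<delta> \<le> norm (grad f y + (\<Sum>i\<in>UNIV. w $ i *\<^sub>R grad (\<lambda>y. g y $ i) y))"
    if "y \<in> C" "(y, w) \<in> approx_compl_set g \<epsilon>" for y w
  proof -
    have "ereal \<delta> \<le> (case (y, w) of (y, w) \<Rightarrow>
        ereal (norm (grad f y + (\<Sum>i\<in>UNIV. w $ i *\<^sub>R grad (\<lambda>y. g y $ i) y))))"
      using that by (intro order_trans[OF less_imp_le[OF \<delta>_less] INF_lower]) auto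
    then show ?thesis by simp
  qed

  obtain R1 where R1: "\<forall>\<^sub>F k in sequentially. norm (lam k) \<le> R1 * norm (real k powr \<tau>)"
    using bigthetaD1[OF lam_Theta] by (elim landau_o.bigE)
  obtain r where r: "r > 0" "\<forall>\<^sub>F k in sequentially. norm (lam k) \<ge> r * norm (real k powr \<tau>)"
    using bigthetaD2[OF lam_Theta] by (elim landau_omega.bigE)
  obtain R2 where R2: "\<forall>\<^sub>F k in sequentially.
      norm (lam (Suc k) - lam k) \<le> R2 * norm (real k powr (- (1 - \<tau>)))"
    using lam_diff by (elim landau_o.bigE)
  obtain R3 where R3: "R3 > 0" "\<forall>\<^sub>F k in sequentially. norm (sig k) \<le> R3 * norm (real k powr (- (1 + \<gamma>)))"
    using bigthetaD1[OF sig_Theta] by (elim landau_o.bigE)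
  define R where "R = max R1 (max R2 R3)"
  have lam_lower: "\<forall>\<^sub>F k in sequentially. r * real k powr \<tau> \<le> lam k"
    using r(2) by eventually_elim (use lam in \<open>simp add: less_imp_le\<close>)
  have lam_upper: "\<forall>\<^sub>F k in sequentially. lam k \<le> R * real k powr \<tau>"
    using R1
  proof eventually_elim
    case (elim k)
    have "lam k \<le> R1 * real k powr \<tau>" using elim lam[of k] by simp
    also have "\<dots> \<le> R * real k powr \<tau>" by (intro mult_right_mono) (auto simp: R_def)
    finally show ?case .
  qed
  have diff_upper: "\<forall>\<^sub>F k in sequentially. lam (Suc k) - lam k \<le> R * real k powr (\<tau> - 1)"
    using R2
  proof eventually_elim
    case (elim k)
    have "lam (Suc k) - lam k \<le> R2 * real k powr (\<tau> - 1)" using elim by simp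
    also have "\<dots> \<le> R * real k powr (\<tau> - 1)" by (intro mult_right_mono) (auto simp: R_def)
    finally show ?case .
  qed
  \<comment> \<open>Since \<open>- (1 + \<gamma>) \<le> \<tau> - 1\<close>, the step sizes
    \<open>sig\<close> fit under the same rate as the increments of \<open>lam\<close>.\<close>
  have sig_upper: "\<forall>\<^sub>F k in sequentially. sig k \<le> R * real k powr (\<tau> - 1)"
    using R3(2) eventually_gt_at_top[of 0]
  proof eventually_elim
    case (elim k)
    have "sig k \<le> R3 * real k powr (- (1 + \<gamma>))" using elim by simp
    also have "\<dots> \<le> R * real k powr (\<tau> - 1)"
      using elim gamma tau R3(1) by (intro mult_mono powr_mono) (auto simp: R_def)
    finally show ?case .
  qed
  have "\<delta> > 0" using \<delta> by simp
  obtain M where M: "M > 0" "\<forall>\<^sub>F k in sequentially. max (excess k) 0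
      \<le> M * real k powr (- min (1 / (1 + \<mu>)) ((2 - 2 * \<tau>) / (1 + \<mu>)))"
    using excess_rate[OF C_unif_convex tau r(1) lam_lower lam_upper diff_upper sig_upper \<epsilon> \<open>\<delta> > 0\<close>]
      lower unfolding mu by blast
  have "(\<lambda>k. real_of_ereal (T k)) \<in>
      O(\<lambda>k. max (1 / real k powr (1 / (1 + \<mu>))) (1 / real k powr ((2 - 2 * \<tau>) / (1 + \<mu>))))"
  proof (rule bigoI)
    show "\<forall>\<^sub>F k in sequentially. norm (real_of_ereal (T k)) \<le> M *
        norm (max (1 / real k powr (1 / (1 + \<mu>))) (1 / real k powr ((2 - 2 * \<tau>) / (1 + \<mu>))))"
      using M(2)
    proof eventually_elim
      case (elim k)
      \<comment> \<open>The smaller exponent yields one of the two entries of the maximum, so either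
        order of the exponents is covered.\<close>
      have "real k powr (- min (1 / (1 + \<mu>)) ((2 - 2 * \<tau>) / (1 + \<mu>)))
          \<le> max (1 / real k powr (1 / (1 + \<mu>))) (1 / real k powr ((2 - 2 * \<tau>) / (1 + \<mu>)))"
        by (cases "1 / (1 + \<mu>) \<le> (2 - 2 * \<tau>) / (1 + \<mu>)")
           (simp_all only: min_def if_True if_False powr_minus_divide max.cobounded1 max.cobounded2)
      from mult_left_mono[OF this, of M] elim M(1)
      have "max (excess k) 0
          \<le> M * max (1 / real k powr (1 / (1 + \<mu>))) (1 / real k powr ((2 - 2 * \<tau>) / (1 + \<mu>)))"
        by linarith
      also have "\<dots> \<le> M *
        norm (max (1 / real k powr (1 / (1 + \<mu>))) (1 / real k powr ((2 - 2 * \<tau>) / (1 + \<mu>))))"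
        using M(1) by (intro mult_left_mono) auto
      finally have "max (excess k) 0 \<le> M *
        norm (max (1 / real k powr (1 / (1 + \<mu>))) (1 / real k powr ((2 - 2 * \<tau>) / (1 + \<mu>))))" .
      moreover have "norm (real_of_ereal (T k)) = max (excess k) 0"
        unfolding Tk real_of_ereal.simps by simp
      ultimately show ?case by simp
    qed
  qed
  moreover have "\<forall>k. \<bar>T k\<bar> \<noteq> \<infinity>"
    unfolding Tk by (metis MInfty_neq_ereal(1) PInfty_neq_ereal(1) ereal_infinity_cases)
  ultimately show ?thesis by blast
qed

end
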